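(* Let $(M,F)$ be a Kähler purely Hermitian complex Finsler space of complex dimension $2$ with $\mathbf K$ a constant on $M$. Then $$R_{\bar rj\bar hk}=\frac{\mathbf K}2\,(g_{j\bar r}g_{k\bar h}+g_{k\bar r}g_{j\bar h}),$$ and the horizontal holomorphic sectional curvatures in directions $\lambda$ and $\mu$ are both equal to $2\mathbf K$.
   Context: $M$ is a complex manifold with $\dim_{\mathbb C}M=2$; $T'M$ is its holomorphic tangent bundle with local coordinates $(z^k,\eta^k)_{k=1,2}$; $\widetilde{T'M}$ is $T'M$ minus the zero section. A complex Finsler space $(M,F)$: $F:T'M\to[0,\infty)$ is continuous, $L:=F^2$ is smooth on $\widetilde{T'M}$, $F(z,\eta)=0$ iff $\eta=0$, $F(z,\lambda\eta)=|\lambda|F(z,\eta)$ for all $\lambda\in\mathbb C$, and the Hermitian matrix $g_{i\bar j}:=\partial^2L/\partial\eta^i\partial\bar\eta^j$ is positive definite on $\widetilde{T'M}$. Repeated indices are summed over $\{1,2\}$; everything lives on $\widetilde{T'M}$; bars on indices denote conjugation. $(g^{\bar m i})$ is the inverse matrix: $g^{\bar m i}g_{j\bar m}=\delta^i_j$. $(M,F)$ is purely Hermitian if $g_{i\bar j}=g_{i\bar j}(z)$ does not depend on $\eta$. Chern–Finsler connection: $\dot\partial_k:=\partial/\partial\eta^k$, $N^k_j:=g^{\bar mk}\frac{\partial g_{l\bar m}}{\partial z^j}\eta^l$, $\delta_k:=\frac{\partial}{\partial z^k}-N^j_k\dot\partial_j$, $\delta_{\bar k}:=\overline{\delta_k}$,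 $L^i_{jk}:=g^{\bar li}\delta_kg_{j\bar l}$, $C^i_{jk}:=g^{\bar li}\dot\partial_kg_{j\bar l}$. Curvature: $R^i_{j\bar hk}:=-\delta_{\bar h}L^i_{jk}-\delta_{\bar h}(N^l_k)C^i_{jl}$, $R_{\bar rj\bar hk}:=g_{i\bar r}R^i_{j\bar hk}$. With $T^i_{jk}:=L^i_{jk}-L^i_{kj}$, the space is Kähler if $T^i_{jk}\eta^j=0$ (known to be equivalent to $T^i_{jk}=0$). In a fixed local chart: $l^i:=\eta^i/F$, $l_i:=\frac1Fg_{i\bar j}\bar\eta^j$, $g:=\det(g_{i\bar j})$, $m^1:=-l_2/\sqrt g$, $m^2:=l_1/\sqrt g$, $\lambda:=l^i\delta_i$, $\mu:=m^i\delta_i$, $J:=l^jl^kl_iL^i_{jk}$. The horizontal curvature invariant is $\mathbf K:=-\frac1F\bar\eta^k\delta_{\bar k}J=R_{\bar rj\bar hk}l^{\bar r}l^jl^{\bar h}l^k$, a function on $\widetilde{T'M}$. The horizontal holomorphic sectional curvatures in directions $\lambda$ and $\mu$ are $2R_{\bar rj\bar hk}l^{\bar r}l^jl^{\bar h}l^k$ and $2R_{\bar rj\bar hk}m^{\bar r}m^jm^{\bar h}m^k$. *)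

theory Defs
  imports "HOL-Analysis.Analysis"
begin

section \<open>Smooth and holomorphic maps\<close>

text \<open>Both notions are meant for open \<open>S\<close>. On a Euclidean space \<open>Ck_on n S f\<close> says that \<open>f\<close> is
  of class \<open>C^n\<close> on \<open>S\<close>.\<close>

primrec Ck_on :: "nat \<Rightarrow> 'a::real_normed_vector set \<Rightarrow> ('a \<Rightarrow> 'b::real_normed_vector) \<Rightarrow> bool" where
  "Ck_on 0 S f \<longleftrightarrow> continuous_on S f"
| "Ck_on (Suc n) S f \<longleftrightarrow>
     (\<forall>x\<in>S. f differentiable (at x)) \<and> (\<forall>v. Ck_on n S (\<lambda>x. frechet_derivative f (at x) v))"

definition smooth_on :: "'a::real_normed_vector set \<Rightarrow> ('a \<Rightarrow> 'b::real_normed_vector) \<Rightarrow> bool" where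
  "smooth_on S f \<longleftrightarrow> (\<forall>n. Ck_on n S f)"

definition holomorphic_map_on :: "(complex^2) set \<Rightarrow> (complex^2 \<Rightarrow> complex^2) \<Rightarrow> bool" where
  "holomorphic_map_on S f \<longleftrightarrow>
     (\<forall>x\<in>S. \<exists>A::complex^2^2. (f has_derivative (\<lambda>h. A *v h)) (at x))"


section \<open>Complex manifolds of dimension 2\<close>

text \<open>A chart is a domain together with a coordinate map; the values of the map outside the domain
  are irrelevant.\<close>

type_synonym 'a chart = "'a set \<times> ('a \<Rightarrow> complex^2)"

definition transition :: "'a chart \<Rightarrow> 'a chart \<Rightarrow> complex^2 \<Rightarrow> complex^2" where
  "transition c d = snd d \<circ> inv_into (fst c) (snd c)"

definition complex_manifold2 :: "'a topology \<Rightarrow> 'a chart set \<Rightarrow> bool" where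
  "complex_manifold2 M \<A> \<longleftrightarrow>
     Hausdorff_space M \<and> second_countable M \<and>
     (\<forall>c\<in>\<A>. openin M (fst c) \<and> open (snd c ` fst c) \<and>
        homeomorphic_map (subtopology M (fst c)) (top_of_set (snd c ` fst c)) (snd c)) \<and>
     (\<Union>c\<in>\<A>. fst c) = topspace M \<and>
     (\<forall>c\<in>\<A>. \<forall>d\<in>\<A>. holomorphic_map_on (snd c ` (fst c \<inter> fst d)) (transition c d))"


section \<open>The holomorphic tangent bundle\<close>

text \<open>A holomorphic tangent vector at \<open>p\<close> is encoded by the family of its components
  \<open>v c = (\<eta>\<^sup>1, \<eta>\<^sup>2)\<close> in the charts \<open>c\<close> around \<open>p\<close>, related by the Jacobians of the transition
  maps. It takes the dummy value 0 at all other arguments, so that equality of vectors is equality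
  of functions.\<close>

definition holo_tangent_space :: "'a chart set \<Rightarrow> 'a \<Rightarrow> ('a chart \<Rightarrow> complex^2) set" where
  "holo_tangent_space \<A> p =
     {v. (\<forall>c. c \<notin> \<A> \<or> p \<notin> fst c \<longrightarrow> v c = 0) \<and>
         (\<forall>c\<in>\<A>. \<forall>d\<in>\<A>. p \<in> fst c \<and> p \<in> fst d \<longrightarrow>
            v d = frechet_derivative (transition c d) (at (snd c p)) (v c))}"

definition holo_tangent_bundle :: "'a set \<Rightarrow> 'a chart set \<Rightarrow> ('a \<times> ('a chart \<Rightarrow> complex^2)) set" where
  "holo_tangent_bundle U \<A> = (SIGMA p:U. holo_tangent_space \<A> p)"

text \<open>The local coordinates \<open>(z, \<eta>)\<close> on the part of the bundle over a chart domain.\<close>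

definition bundle_chart :: "'a chart \<Rightarrow> 'a \<times> ('a chart \<Rightarrow> complex^2) \<Rightarrow> (complex^2) \<times> (complex^2)" where
  "bundle_chart c = (\<lambda>(p, v). (snd c p, v c))"

definition local_rep ::
  "'a chart set \<Rightarrow> 'a chart \<Rightarrow> ('a \<times> ('a chart \<Rightarrow> complex^2) \<Rightarrow> real) \<Rightarrow> (complex^2) \<times> (complex^2) \<Rightarrow> real" where
  "local_rep \<A> c F = F \<circ> inv_into (holo_tangent_bundle (fst c) \<A>) (bundle_chart c)"

text \<open>The coordinate domain of the bundle over a chart, with the zero section removed.\<close>

definition slit_domain :: "'a chart \<Rightarrow> ((complex^2) \<times> (complex^2)) set" where
  "slit_domain c = snd c ` fst c \<times> (UNIV - {0})"


section \<open>Wirtinger derivatives in the coordinates of the bundle\<close>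

definition wirtinger ::
  "'v::real_normed_vector \<Rightarrow> 'v \<Rightarrow> ('v \<Rightarrow> complex) \<Rightarrow> 'v \<Rightarrow> complex" where
  "wirtinger x y f u =
     (frechet_derivative f (at u) x - \<i> * frechet_derivative f (at u) y) / 2"

definition wirtinger_bar ::
  "'v::real_normed_vector \<Rightarrow> 'v \<Rightarrow> ('v \<Rightarrow> complex) \<Rightarrow> 'v \<Rightarrow> complex" where
  "wirtinger_bar x y f u =
     (frechet_derivative f (at u) x + \<i> * frechet_derivative f (at u) y) / 2"

type_synonym coords = "(complex^2) \<times> (complex^2)"

definition d_z :: "2 \<Rightarrow> (coords \<Rightarrow> complex) \<Rightarrow> coords \<Rightarrow> complex" where
  "d_z k = wirtinger (axis k 1, 0) (axis k \<i>, 0)"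

definition d_zbar :: "2 \<Rightarrow> (coords \<Rightarrow> complex) \<Rightarrow> coords \<Rightarrow> complex" where
  "d_zbar k = wirtinger_bar (axis k 1, 0) (axis k \<i>, 0)"

definition d_eta :: "2 \<Rightarrow> (coords \<Rightarrow> complex) \<Rightarrow> coords \<Rightarrow> complex" where
  "d_eta k = wirtinger (0, axis k 1) (0, axis k \<i>)"

definition d_etabar :: "2 \<Rightarrow> (coords \<Rightarrow> complex) \<Rightarrow> coords \<Rightarrow> complex" where
  "d_etabar k = wirtinger_bar (0, axis k 1) (0, axis k \<i>)"


section \<open>Complex Finsler spaces\<close>

text \<open>From here on \<open>f\<close> is the local representative of \<open>F\<close> in a chart and \<open>u = (z, \<eta>)\<close> a point of
  the slit coordinate domain. The entry \<open>levi_metric f u $ i $ j\<close> is \<open>g\<close> with lower indices \<open>i\<close>, \<open>j\<close>-bar,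
  and \<open>levi_metric_inv f u $ m $ i\<close> is \<open>g\<close> with upper indices \<open>m\<close>-bar, \<open>i\<close>.\<close>

definition levi_metric :: "(coords \<Rightarrow> real) \<Rightarrow> coords \<Rightarrow> complex^2^2" where
  "levi_metric f u = (\<chi> i j. d_eta i (d_etabar j (\<lambda>w. complex_of_real ((f w)\<^sup>2))) u)"

definition levi_metric_inv :: "(coords \<Rightarrow> real) \<Rightarrow> coords \<Rightarrow> complex^2^2" where
  "levi_metric_inv f u = matrix_inv (levi_metric f u)"

definition hermitian_pos_def :: "complex^2^2 \<Rightarrow> bool" where
  "hermitian_pos_def A \<longleftrightarrow>
     (\<forall>i j. A $ i $ j = cnj (A $ j $ i)) \<and>
     (\<forall>v. v \<noteq> 0 \<longrightarrow> 0 < Re (\<Sum>i\<in>UNIV. \<Sum>j\<in>UNIV. A $ i $ j * v $ i * cnj (v $ j)))"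

text \<open>Continuity and smoothness on the bundle are, as usual, expressed in its local coordinates.\<close>

definition complex_finsler_space2 ::
  "'a topology \<Rightarrow> 'a chart set \<Rightarrow> ('a \<times> ('a chart \<Rightarrow> complex^2) \<Rightarrow> real) \<Rightarrow> bool" where
  "complex_finsler_space2 M \<A> F \<longleftrightarrow>
     complex_manifold2 M \<A> \<and>
     (\<forall>c\<in>\<A>. continuous_on (snd c ` fst c \<times> UNIV) (local_rep \<A> c F)) \<and>
     (\<forall>c\<in>\<A>. smooth_on (slit_domain c) (\<lambda>u. (local_rep \<A> c F u)\<^sup>2)) \<and>
     (\<forall>p\<in>topspace M. \<forall>v\<in>holo_tangent_space \<A> p.
        0 \<le> F (p, v) \<and> (F (p, v) = 0 \<longleftrightarrow> v = (\<lambda>c. 0)) \<and>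
        (\<forall>a::complex. F (p, \<lambda>c. a *s v c) = cmod a * F (p, v))) \<and>
     (\<forall>c\<in>\<A>. \<forall>u\<in>slit_domain c. hermitian_pos_def (levi_metric (local_rep \<A> c F) u))"

definition purely_hermitian ::
  "'a chart set \<Rightarrow> ('a \<times> ('a chart \<Rightarrow> complex^2) \<Rightarrow> real) \<Rightarrow> bool" where
  "purely_hermitian \<A> F \<longleftrightarrow>
     (\<forall>c\<in>\<A>. \<forall>z \<eta> \<eta>'. (z, \<eta>) \<in> slit_domain c \<longrightarrow> (z, \<eta>') \<in> slit_domain c \<longrightarrow>
        levi_metric (local_rep \<A> c F) (z, \<eta>) = levi_metric (local_rep \<A> c F) (z, \<eta>'))"


section \<open>The Chern--Finsler connection and its curvature\<close>

text \<open>In \<open>N f u k j\<close>, \<open>Lc f u i j k\<close>, \<open>Cc f u i j k\<close> and \<open>Rc f u i j h k\<close> the first index is the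
  upper one.\<close>

definition N :: "(coords \<Rightarrow> real) \<Rightarrow> coords \<Rightarrow> 2 \<Rightarrow> 2 \<Rightarrow> complex" where
  "N f u k j = (\<Sum>m\<in>UNIV. \<Sum>l\<in>UNIV.
     levi_metric_inv f u $ m $ k * d_z j (\<lambda>w. levi_metric f w $ l $ m) u * snd u $ l)"

definition delta :: "(coords \<Rightarrow> real) \<Rightarrow> 2 \<Rightarrow> (coords \<Rightarrow> complex) \<Rightarrow> coords \<Rightarrow> complex" where
  "delta f k \<phi> u = d_z k \<phi> u - (\<Sum>j\<in>UNIV. N f u j k * d_eta j \<phi> u)"

definition delta_bar :: "(coords \<Rightarrow> real) \<Rightarrow> 2 \<Rightarrow> (coords \<Rightarrow> complex) \<Rightarrow> coords \<Rightarrow> complex" where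
  "delta_bar f k \<phi> u = d_zbar k \<phi> u - (\<Sum>j\<in>UNIV. cnj (N f u j k) * d_etabar j \<phi> u)"

definition Lc :: "(coords \<Rightarrow> real) \<Rightarrow> coords \<Rightarrow> 2 \<Rightarrow> 2 \<Rightarrow> 2 \<Rightarrow> complex" where
  "Lc f u i j k = (\<Sum>l\<in>UNIV. levi_metric_inv f u $ l $ i * delta f k (\<lambda>w. levi_metric f w $ j $ l) u)"

definition Cc :: "(coords \<Rightarrow> real) \<Rightarrow> coords \<Rightarrow> 2 \<Rightarrow> 2 \<Rightarrow> 2 \<Rightarrow> complex" where
  "Cc f u i j k = (\<Sum>l\<in>UNIV. levi_metric_inv f u $ l $ i * d_eta k (\<lambda>w. levi_metric f w $ j $ l) u)"

definition Rc :: "(coords \<Rightarrow> real) \<Rightarrow> coords \<Rightarrow> 2 \<Rightarrow> 2 \<Rightarrow> 2 \<Rightarrow> 2 \<Rightarrow> complex" where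
  "Rc f u i j h k =
     - delta_bar f h (\<lambda>w. Lc f w i j k) u
     - (\<Sum>l\<in>UNIV. delta_bar f h (\<lambda>w. N f w l k) u * Cc f u i j l)"

text \<open>All indices lowered: \<open>R_low f u r j h k\<close> has indices \<open>r\<close>-bar, \<open>j\<close>, \<open>h\<close>-bar, \<open>k\<close>.\<close>

definition R_low :: "(coords \<Rightarrow> real) \<Rightarrow> coords \<Rightarrow> 2 \<Rightarrow> 2 \<Rightarrow> 2 \<Rightarrow> 2 \<Rightarrow> complex" where
  "R_low f u r j h k = (\<Sum>i\<in>UNIV. levi_metric f u $ i $ r * Rc f u i j h k)"

definition torsion :: "(coords \<Rightarrow> real) \<Rightarrow> coords \<Rightarrow> 2 \<Rightarrow> 2 \<Rightarrow> 2 \<Rightarrow> complex" where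
  "torsion f u i j k = Lc f u i j k - Lc f u i k j"

definition kaehler ::
  "'a chart set \<Rightarrow> ('a \<times> ('a chart \<Rightarrow> complex^2) \<Rightarrow> real) \<Rightarrow> bool" where
  "kaehler \<A> F \<longleftrightarrow>
     (\<forall>c\<in>\<A>. \<forall>u\<in>slit_domain c. \<forall>i k.
        (\<Sum>j\<in>UNIV. torsion (local_rep \<A> c F) u i j k * snd u $ j) = 0)"


section \<open>The local frame and the horizontal curvature invariant\<close>

definition l_up :: "(coords \<Rightarrow> real) \<Rightarrow> coords \<Rightarrow> complex^2" where
  "l_up f u = (\<chi> i. snd u $ i / complex_of_real (f u))"

definition l_low :: "(coords \<Rightarrow> real) \<Rightarrow> coords \<Rightarrow> complex^2" where
  "l_low f u = (\<chi> i. (1 / complex_of_real (f u)) * (\<Sum>j\<in>UNIV. levi_metric f u $ i $ j * cnj (snd u $ j)))"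

text \<open>The determinant of the metric is a positive real, on which \<open>csqrt\<close> is the positive root.\<close>

definition m_up :: "(coords \<Rightarrow> real) \<Rightarrow> coords \<Rightarrow> complex^2" where
  "m_up f u = (\<chi> i. if i = 1 then - (l_low f u $ 2) / csqrt (det (levi_metric f u))
                    else l_low f u $ 1 / csqrt (det (levi_metric f u)))"

definition J :: "(coords \<Rightarrow> real) \<Rightarrow> coords \<Rightarrow> complex" where
  "J f u = (\<Sum>j\<in>UNIV. \<Sum>k\<in>UNIV. \<Sum>i\<in>UNIV.
     l_up f u $ j * l_up f u $ k * l_low f u $ i * Lc f u i j k)"

definition K_inv :: "(coords \<Rightarrow> real) \<Rightarrow> coords \<Rightarrow> complex" where
  "K_inv f u = - (1 / complex_of_real (f u)) * (\<Sum>k\<in>UNIV. cnj (snd u $ k) * delta_bar f k (J f) u)"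

text \<open>The horizontal holomorphic sectional curvature in the direction \<open>X\<^sup>i \<delta>\<^sub>i\<close>, for a vector \<open>X\<close> of
  unit length; it is used for \<open>\<lambda>\<close> (with \<open>X = l_up f u\<close>) and \<open>\<mu>\<close> (with \<open>X = m_up f u\<close>).\<close>

definition horizontal_hsc :: "(coords \<Rightarrow> real) \<Rightarrow> coords \<Rightarrow> complex^2 \<Rightarrow> complex" where
  "horizontal_hsc f u X = 2 * (\<Sum>r\<in>UNIV. \<Sum>j\<in>UNIV. \<Sum>h\<in>UNIV. \<Sum>k\<in>UNIV.
     R_low f u r j h k * cnj (X $ r) * X $ j * cnj (X $ h) * X $ k)"

end

theory Submission
  imports Defs
begin

text \<open>In the purely Hermitian case \<open>g\<close> depends on the base point only, so the vertical terms of the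
  curvature vanish and \<open>R\<close> lives on the base. Lowering an index in the definition of the connection
  gives \<open>R_low r j h k = (\<Sum>i. d_zbar h (g i r) * Lc i j k) - d_zbar h (d_z k (g j r))\<close>, which the
  Kaehler condition and the equality of mixed second derivatives make symmetric in \<open>j, k\<close> and in
  \<open>r, h\<close>. Since \<open>F\<close> is annihilated by the conjugate horizontal derivatives, the invariant \<open>K\<close>
  satisfies \<open>K * F^4 = R(\<eta>, \<eta>, \<eta>, \<eta>)\<close>, where \<open>F^2 = g(\<eta>, \<eta>)\<close> by homogeneity. For constant \<open>K\<close>
  both sides are forms of bidegree \<open>(2, 2)\<close> in \<open>\<eta>\<close>, and polarization gives the curvature tensor.
  Evaluating it on a unit vector yields \<open>2 K\<close>.\<close>

section \<open>Second derivatives and smoothness\<close>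

text \<open>Two applications of the mean value theorem: first along \<open>v\<close> to the
  increment of \<open>f\<close> in direction \<open>h *\<^sub>R w\<close>, then along
  \<open>w\<close> to the directional derivative \<open>Df x v\<close>. Swapping \<open>v\<close>
  and \<open>w\<close> leaves the left-hand side unchanged, which is what makes it useful for
  symmetry.\<close>

lemma mixed_difference_mvt:
  fixes f :: "'a::real_normed_vector \<Rightarrow> real"
  assumes box: "\<And>s t. 0 \<le> s \<Longrightarrow> s \<le> h \<Longrightarrow> 0 \<le> t \<Longrightarrow> t \<le> h \<Longrightarrow> u + s *\<^sub>R v + t *\<^sub>R w \<in> S"
    and f: "\<And>x. x \<in> S \<Longrightarrow> (f has_derivative Df x) (at x)"
    and Df: "\<And>x. x \<in> S \<Longrightarrow> ((\<lambda>x. Df x v) has_derivative Dv x) (at x)"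
    and "0 < h"
  obtains \<sigma> \<tau> where "0 < \<sigma>" "\<sigma> < h" "0 < \<tau>" "\<tau> < h"
    "f (u + h *\<^sub>R v + h *\<^sub>R w) - f (u + h *\<^sub>R v) - f (u + h *\<^sub>R w) + f u
       = h * h * Dv (u + \<sigma> *\<^sub>R v + \<tau> *\<^sub>R w) w"
proof -
  have lin: "linear (Df x)" "linear (Dv x)" if "x \<in> S" for x
    using f Df that has_derivative_linear by blast+
  define \<phi> where "\<phi> s = f (u + s *\<^sub>R v + h *\<^sub>R w) - f (u + s *\<^sub>R v)" for s
  have "(\<phi> has_derivative
      (\<lambda>r. r * (Df (u + s *\<^sub>R v + h *\<^sub>R w) v - Df (u + s *\<^sub>R v) v))) (at s)"
    if "0 \<le> s" "s \<le> h" for s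
  proof -
    have S: "u + s *\<^sub>R v + h *\<^sub>R w \<in> S" "u + s *\<^sub>R v \<in> S"
      using box[of s h] box[of s 0] that \<open>0 < h\<close> by auto
    have "((\<lambda>s. f (u + s *\<^sub>R v + h *\<^sub>R w)) has_derivative
        (\<lambda>r. Df (u + s *\<^sub>R v + h *\<^sub>R w) (r *\<^sub>R v))) (at s)"
      by (rule has_derivative_compose[of "\<lambda>s. u + s *\<^sub>R v + h *\<^sub>R w" "\<lambda>r. r *\<^sub>R v", OF _ f[OF S(1)]])
        (auto intro!: derivative_eq_intros)
    moreover have "((\<lambda>s. f (u + s *\<^sub>R v)) has_derivative
        (\<lambda>r. Df (u + s *\<^sub>R v) (r *\<^sub>R v))) (at s)"
      by (rule has_derivative_compose[of "\<lambda>s. u + s *\<^sub>R v" "\<lambda>r. r *\<^sub>R v", OF _ f[OF S(2)]])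
        (auto intro!: derivative_eq_intros)
    ultimately show ?thesis
      unfolding \<phi>_def
      by (rule has_derivative_diff[THEN has_derivative_eq_rhs])
        (simp add: fun_eq_iff linear_cmul[OF lin(1)[OF S(1)]] linear_cmul[OF lin(1)[OF S(2)]] right_diff_distrib)
  qed
  then have D\<phi>: "(\<phi> has_field_derivative
      (Df (u + s *\<^sub>R v + h *\<^sub>R w) v - Df (u + s *\<^sub>R v) v)) (at s)" if "0 \<le> s" "s \<le> h" for s
    using that by (simp add: has_field_derivative_def mult.commute[of _ "_ - _"])
  obtain \<sigma> where \<sigma>: "0 < \<sigma>" "\<sigma> < h"
    "\<phi> h - \<phi> 0 = (h - 0) * (Df (u + \<sigma> *\<^sub>R v + h *\<^sub>R w) v - Df (u + \<sigma> *\<^sub>R v) v)"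
    using MVT2[OF \<open>0 < h\<close>, of \<phi>, OF D\<phi>] by blast
  define \<psi> where "\<psi> t = Df (u + \<sigma> *\<^sub>R v + t *\<^sub>R w) v" for t
  have D\<psi>: "(\<psi> has_field_derivative Dv (u + \<sigma> *\<^sub>R v + t *\<^sub>R w) w) (at t)" if "0 \<le> t" "t \<le> h" for t
  proof -
    have S: "u + \<sigma> *\<^sub>R v + t *\<^sub>R w \<in> S"
      using box[of \<sigma> t] that \<sigma> by auto
    have "(\<psi> has_derivative (\<lambda>r. Dv (u + \<sigma> *\<^sub>R v + t *\<^sub>R w) (r *\<^sub>R w))) (at t)"
      unfolding \<psi>_def
      by (rule has_derivative_compose[of "\<lambda>t. u + \<sigma> *\<^sub>R v + t *\<^sub>R w" "\<lambda>r. r *\<^sub>R w", OF _ Df[OF S]])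
        (auto intro!: derivative_eq_intros)
    then show ?thesis
      by (simp add: has_field_derivative_def linear_cmul[OF lin(2)[OF S]] mult.commute[of _ "Dv _ _"])
  qed
  obtain \<tau> where \<tau>: "0 < \<tau>" "\<tau> < h"
    "\<psi> h - \<psi> 0 = (h - 0) * Dv (u + \<sigma> *\<^sub>R v + \<tau> *\<^sub>R w) w"
    using MVT2[OF \<open>0 < h\<close>, of \<psi>, OF D\<psi>] by blast
  show ?thesis
    by (rule that[of \<sigma> \<tau>]) (use \<sigma> \<tau> in \<open>auto simp: \<phi>_def \<psi>_def\<close>)
qed

text \<open>The mixed difference is symmetric in \<open>v\<close> and \<open>w\<close>, so it
  equates a value of \<open>Dv\<close> with a value of \<open>Dw\<close> at two points close to
  \<open>u\<close>. If the values at \<open>u\<close> differed, continuity would keep the nearby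
  values apart.\<close>

lemma symmetric_second_derivative_real:
  fixes f :: "'a::real_normed_vector \<Rightarrow> real"
  assumes S: "open S" "u \<in> S"
    and f: "\<And>x. x \<in> S \<Longrightarrow> (f has_derivative Df x) (at x)"
    and Dv: "\<And>x. x \<in> S \<Longrightarrow> ((\<lambda>x. Df x v) has_derivative Dv x) (at x)"
    and Dw: "\<And>x. x \<in> S \<Longrightarrow> ((\<lambda>x. Df x w) has_derivative Dw x) (at x)"
    and cont: "isCont (\<lambda>x. Dv x w) u" "isCont (\<lambda>x. Dw x v) u"
  shows "Dv u w = Dw u v"
proof (rule ccontr)
  assume ne: "Dv u w \<noteq> Dw u v"
  \<comment> \<open>Half the gap: two numbers, each strictly within \<open>e\<close> of one of the
    two values, cannot coincide.\<close>
  define e where "e = \<bar>Dv u w - Dw u v\<bar> / 2"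
  have "e > 0" using ne by (simp add: e_def)
  obtain d0 where d0: "d0 > 0" "\<And>x. dist x u < d0 \<Longrightarrow> x \<in> S"
    using S by (meson open_dist)
  obtain d1 where d1: "d1 > 0" "\<And>x. dist x u < d1 \<Longrightarrow> \<bar>Dv x w - Dv u w\<bar> < e"
    using cont(1) \<open>e > 0\<close> unfolding continuous_at_eps_delta dist_real_def by meson
  obtain d2 where d2: "d2 > 0" "\<And>x. dist x u < d2 \<Longrightarrow> \<bar>Dw x v - Dw u v\<bar> < e"
    using cont(2) \<open>e > 0\<close> unfolding continuous_at_eps_delta dist_real_def by meson
  define d where "d = min d0 (min d1 d2)"
  \<comment> \<open>With \<open>h = d / (2 * n)\<close> the parallelogram spanned by
    \<open>h *\<^sub>R v\<close> and \<open>h *\<^sub>R w\<close> stays in the ball of radius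
    \<open>d\<close>; the summand 1 keeps \<open>n\<close> positive when both vectors
    vanish.\<close>
  define n where "n = norm v + norm w + 1"
  define h where "h = d / (2 * n)"
  have "d > 0" using d0 d1 d2 by (simp add: d_def)
  have pos: "n > 0"
    by (simp add: n_def add_nonneg_pos)
  then have "h > 0" using \<open>d > 0\<close> by (simp add: h_def)
  have near: "dist (u + s *\<^sub>R v + t *\<^sub>R w) u < d" if "0 \<le> s" "s \<le> h" "0 \<le> t" "t \<le> h" for s t
  proof -
    have "dist (u + s *\<^sub>R v + t *\<^sub>R w) u \<le> s * norm v + t * norm w"
      using that norm_triangle_ineq[of "s *\<^sub>R v" "t *\<^sub>R w"] by (simp add: dist_norm)
    also have "\<dots> \<le> h * norm v + h * norm w"
      using that by (intro add_mono mult_right_mono) auto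
    also have "\<dots> \<le> h * n"
      using \<open>h > 0\<close> by (simp add: n_def algebra_simps)
    also have "\<dots> = d / 2" using pos by (simp add: h_def)
    also have "\<dots> < d" using \<open>d > 0\<close> by simp
    finally show ?thesis .
  qed
  have near': "dist (u + s *\<^sub>R w + t *\<^sub>R v) u < d" if "0 \<le> s" "s \<le> h" "0 \<le> t" "t \<le> h" for s t
    using near[OF that(3,4,1,2)] by (simp add: add_ac)
  obtain a b where ab: "0 < a" "a < h" "0 < b" "b < h"
    "f (u + h *\<^sub>R v + h *\<^sub>R w) - f (u + h *\<^sub>R v) - f (u + h *\<^sub>R w) + f u
       = h * h * Dv (u + a *\<^sub>R v + b *\<^sub>R w) w"
    by (rule mixed_difference_mvt[OF _ f Dv \<open>h > 0\<close>, where u = u and S = S])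
      (use near d0 in \<open>auto simp: d_def\<close>)
  obtain a' b' where ab': "0 < a'" "a' < h" "0 < b'" "b' < h"
    "f (u + h *\<^sub>R w + h *\<^sub>R v) - f (u + h *\<^sub>R w) - f (u + h *\<^sub>R v) + f u
       = h * h * Dw (u + a' *\<^sub>R w + b' *\<^sub>R v) v"
    by (rule mixed_difference_mvt[OF _ f Dw \<open>h > 0\<close>, where u = u and S = S])
      (use near' d0 in \<open>auto simp: d_def\<close>)
  have "Dv (u + a *\<^sub>R v + b *\<^sub>R w) w = Dw (u + a' *\<^sub>R w + b' *\<^sub>R v) v"
  proof -
    have "f (u + h *\<^sub>R w + h *\<^sub>R v) = f (u + h *\<^sub>R v + h *\<^sub>R w)"
      by (simp add: add_ac)
    then have "h * h * Dv (u + a *\<^sub>R v + b *\<^sub>R w) w = h * h * Dw (u + a' *\<^sub>R w + b' *\<^sub>R v) v"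
      using ab(5) ab'(5) by linarith
    then show ?thesis
      using \<open>h > 0\<close> by simp
  qed
  moreover have "\<bar>Dv (u + a *\<^sub>R v + b *\<^sub>R w) w - Dv u w\<bar> < e"
    using near[of a b] ab d1 by (simp add: d_def)
  moreover have "\<bar>Dw (u + a' *\<^sub>R w + b' *\<^sub>R v) v - Dw u v\<bar> < e"
    using near'[of a' b'] ab' d2 by (simp add: d_def)
  ultimately show False by (simp add: e_def abs_if split: if_splits)
qed

text \<open>The mean value theorem is a real statement, so real and imaginary parts are treated
  separately.\<close>

lemma symmetric_second_derivative:
  fixes f :: "'a::real_normed_vector \<Rightarrow> complex"
  assumes S: "open S" "u \<in> S" and f: "Ck_on 2 S f"
  shows "frechet_derivative (\<lambda>x. frechet_derivative f (at x) v) (at u) w =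
         frechet_derivative (\<lambda>x. frechet_derivative f (at x) w) (at u) v"
proof -
  define Df where "Df x = frechet_derivative f (at x)" for x
  define D2 where "D2 v x = frechet_derivative (\<lambda>x. Df x v) (at x)" for v x
  have Df: "(f has_derivative Df x) (at x)" if "x \<in> S" for x
    using f that by (simp add: numeral_2_eq_2 Df_def frechet_derivative_works)
  have D2: "((\<lambda>x. Df x v) has_derivative D2 v x) (at x)" if "x \<in> S" for x v
    using f that by (simp add: numeral_2_eq_2 D2_def Df_def frechet_derivative_works)
  have cont: "isCont (\<lambda>x. D2 v x w) u" for v w
    using f S by (simp add: numeral_2_eq_2 D2_def Df_def continuous_on_eq_continuous_at)
  have "Re (D2 v u w) = Re (D2 w u v)"
    by (rule symmetric_second_derivative_real[OF S, of "\<lambda>x. Re (f x)" "\<lambda>x h. Re (Df x h)"])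
      (intro has_derivative_Re Df D2 continuous_Re cont; assumption)+
  moreover have "Im (D2 v u w) = Im (D2 w u v)"
    by (rule symmetric_second_derivative_real[OF S, of "\<lambda>x. Im (f x)" "\<lambda>x h. Im (Df x h)"])
      (intro has_derivative_Im Df D2 continuous_Im cont; assumption)+
  ultimately show ?thesis by (simp add: D2_def Df_def complex_eq_iff)
qed

section \<open>Closure properties of \<open>Ck_on\<close> and \<open>smooth_on\<close>\<close>

lemma Ck_on_cong:
  assumes "open S" "\<And>x. x \<in> S \<Longrightarrow> f x = g x" "Ck_on n S f"
  shows "Ck_on n S g"
  using assms(2,3)
proof (induction n arbitrary: f g)
  case 0
  then show ?case by (simp cong: continuous_on_cong)
next
  case (Suc n)
  have D: "(g has_derivative frechet_derivative f (at x)) (at x)" if "x \<in> S" for x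
    using Suc.prems that \<open>open S\<close>
    by (auto simp: frechet_derivative_works intro: has_derivative_transform_within_open)
  then have eq: "frechet_derivative f (at x) = frechet_derivative g (at x)" if "x \<in> S" for x
    using that frechet_derivative_at by blast
  have "Ck_on n S (\<lambda>x. frechet_derivative g (at x) v)" for v
    by (rule Suc.IH[of "\<lambda>x. frechet_derivative f (at x) v"]) (use Suc.prems eq in auto)
  then show ?case using D by (auto simp: differentiable_def)
qed

text \<open>Differentiation commutes with \<open>h\<close>, so the induction applies to the
  directional derivatives. The instances used later are multiplication by a complex constant and the
  embedding of the reals.\<close>

lemma Ck_on_bounded_linear:
  assumes S: "open S" and h: "bounded_linear h" and "Ck_on n S f"
  shows "Ck_on n S (\<lambda>x. h (f x))"
  using assms(3)
proof (induction n arbitrary: f)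
  case 0
  then show ?case by (simp add: bounded_linear.continuous_on[OF h])
next
  case (Suc n)
  have D: "((\<lambda>x. h (f x)) has_derivative (\<lambda>v. h (frechet_derivative f (at x) v))) (at x)"
    if "x \<in> S" for x
    using Suc.prems that by (intro bounded_linear.has_derivative[OF h]) (simp add: frechet_derivative_works)
  then have eq: "(\<lambda>v. h (frechet_derivative f (at x) v)) = frechet_derivative (\<lambda>x. h (f x)) (at x)"
    if "x \<in> S" for x
    using that frechet_derivative_at by blast
  have "Ck_on n S (\<lambda>x. frechet_derivative (\<lambda>x. h (f x)) (at x) v)" for v
    by (rule Ck_on_cong[OF S, of "\<lambda>x. h (frechet_derivative f (at x) v)"])
      (use Suc eq in \<open>auto dest: fun_cong\<close>)
  then show ?case using D by (auto simp: differentiable_def)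
qed

lemma Ck_on_add:
  assumes S: "open S" and "Ck_on n S f" "Ck_on n S g"
  shows "Ck_on n S (\<lambda>x. f x + g x)"
  using assms(2,3)
proof (induction n arbitrary: f g)
  case 0
  then show ?case by (simp add: continuous_on_add)
next
  case (Suc n)
  have D: "((\<lambda>x. f x + g x) has_derivative
      (\<lambda>v. frechet_derivative f (at x) v + frechet_derivative g (at x) v)) (at x)"
    if "x \<in> S" for x
    using Suc.prems that by (intro has_derivative_add) (simp_all add: frechet_derivative_works)
  then have eq: "(\<lambda>v. frechet_derivative f (at x) v + frechet_derivative g (at x) v) =
      frechet_derivative (\<lambda>x. f x + g x) (at x)" if "x \<in> S" for x
    using that frechet_derivative_at by blast
  have "Ck_on n S (\<lambda>x. frechet_derivative (\<lambda>x. f x + g x) (at x) v)" for v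
    by (rule Ck_on_cong[OF S, of "\<lambda>x. frechet_derivative f (at x) v + frechet_derivative g (at x) v"])
      (use Suc eq in \<open>auto dest: fun_cong\<close>)
  then show ?case using D by (auto simp: differentiable_def)
qed

lemma smooth_on_frechet_derivative:
  "smooth_on S f \<Longrightarrow> smooth_on S (\<lambda>x. frechet_derivative f (at x) v)"
  unfolding smooth_on_def by (metis Ck_on.simps(2))

lemma smooth_on_bounded_linear:
  "open S \<Longrightarrow> bounded_linear h \<Longrightarrow> smooth_on S f \<Longrightarrow> smooth_on S (\<lambda>x. h (f x))"
  by (simp add: smooth_on_def Ck_on_bounded_linear)

lemma smooth_on_add:
  "open S \<Longrightarrow> smooth_on S f \<Longrightarrow> smooth_on S g \<Longrightarrow> smooth_on S (\<lambda>x. f x + g x)"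
  by (simp add: smooth_on_def Ck_on_add)

lemma smooth_on_imp_differentiable: "smooth_on S f \<Longrightarrow> x \<in> S \<Longrightarrow> f differentiable (at x)"
  unfolding smooth_on_def by (metis Ck_on.simps(2))

lemma smooth_on_wirtinger:
  assumes "open S" "smooth_on S f"
  shows "smooth_on S (wirtinger x y f)" "smooth_on S (wirtinger_bar x y f)"
proof -
  let ?X = "\<lambda>u. frechet_derivative f (at u) x" and ?Y = "\<lambda>u. frechet_derivative f (at u) y"
  have s: "smooth_on S (\<lambda>u. (1/2) * ?X u)" "smooth_on S (\<lambda>u. (\<i>/2) * ?Y u)" "smooth_on S (\<lambda>u. (-\<i>/2) * ?Y u)"
    by (intro smooth_on_bounded_linear[where h = "\<lambda>z. c * z" for c] smooth_on_frechet_derivative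
        bounded_linear_mult_right assms)+
  have "wirtinger x y f = (\<lambda>u. (1/2) * ?X u + (-\<i>/2) * ?Y u)"
    "wirtinger_bar x y f = (\<lambda>u. (1/2) * ?X u + (\<i>/2) * ?Y u)"
    by (auto simp: wirtinger_def wirtinger_bar_def field_simps)
  then show "smooth_on S (wirtinger x y f)" "smooth_on S (wirtinger_bar x y f)"
    using s assms(1) by (auto intro!: smooth_on_add simp only:)
qed

lemma wirtinger_eq:
  assumes "(f has_derivative f') (at u)"
  shows "wirtinger x y f u = (f' x - \<i> * f' y) / 2"
    and "wirtinger_bar x y f u = (f' x + \<i> * f' y) / 2"
  using frechet_derivative_at[OF assms] by (simp_all add: wirtinger_def wirtinger_bar_def)

text \<open>Both sides expand to the same complex combination of four second directional derivatives
  once these are known to be symmetric.\<close>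

lemma wirtinger_commute:
  assumes S: "open S" "u \<in> S" and f: "smooth_on S f"
  shows "wirtinger_bar a b (wirtinger x y f) u = wirtinger x y (wirtinger_bar a b f) u"
proof -
  define D where "D v u = frechet_derivative f (at u) v" for v u
  have D: "(D v has_derivative frechet_derivative (D v) (at u)) (at u)" for v
    using smooth_on_imp_differentiable[OF smooth_on_frechet_derivative[OF f] S(2)]
    by (simp add: frechet_derivative_works D_def[abs_def])
  have 1: "((\<lambda>u. (D x u - \<i> * D y u) / 2) has_derivative
      (\<lambda>h. (frechet_derivative (D x) (at u) h - \<i> * frechet_derivative (D y) (at u) h) / 2)) (at u)"
    by (auto intro!: derivative_eq_intros D)
  have 2: "((\<lambda>u. (D a u + \<i> * D b u) / 2) has_derivative
      (\<lambda>h. (frechet_derivative (D a) (at u) h + \<i> * frechet_derivative (D b) (at u) h) / 2)) (at u)"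
    by (auto intro!: derivative_eq_intros D)
  have sym: "frechet_derivative (D v) (at u) w = frechet_derivative (D w) (at u) v" for v w
    unfolding D_def using symmetric_second_derivative[OF S] f by (simp add: smooth_on_def)
  have e: "wirtinger x y f = (\<lambda>u. (D x u - \<i> * D y u) / 2)"
    "wirtinger_bar a b f = (\<lambda>u. (D a u + \<i> * D b u) / 2)"
    by (auto simp: wirtinger_def wirtinger_bar_def D_def)
  show ?thesis
    unfolding e wirtinger_eq(2)[OF 1] wirtinger_eq(1)[OF 2] sym[of a] sym[of b]
    by (simp add: field_simps)
qed

section \<open>Wirtinger calculus\<close>

lemma wirtinger_add:
  assumes "\<phi> differentiable (at u)" "\<psi> differentiable (at u)"
  shows "wirtinger x y (\<lambda>w. \<phi> w + \<psi> w) u = wirtinger x y \<phi> u + wirtinger x y \<psi> u"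
    and "wirtinger_bar x y (\<lambda>w. \<phi> w + \<psi> w) u = wirtinger_bar x y \<phi> u + wirtinger_bar x y \<psi> u"
proof -
  note * = has_derivative_add[OF assms[unfolded frechet_derivative_works]]
  show "wirtinger x y (\<lambda>w. \<phi> w + \<psi> w) u = wirtinger x y \<phi> u + wirtinger x y \<psi> u"
    unfolding wirtinger_eq(1)[OF *] by (simp add: wirtinger_def field_simps)
  show "wirtinger_bar x y (\<lambda>w. \<phi> w + \<psi> w) u = wirtinger_bar x y \<phi> u + wirtinger_bar x y \<psi> u"
    unfolding wirtinger_eq(2)[OF *] by (simp add: wirtinger_bar_def field_simps)
qed

lemma wirtinger_mult:
  assumes "\<phi> differentiable (at u)" "\<psi> differentiable (at u)"
  shows "wirtinger x y (\<lambda>w. \<phi> w * \<psi> w) u = \<phi> u * wirtinger x y \<psi> u + wirtinger x y \<phi> u * \<psi> u"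
    and "wirtinger_bar x y (\<lambda>w. \<phi> w * \<psi> w) u =
      \<phi> u * wirtinger_bar x y \<psi> u + wirtinger_bar x y \<phi> u * \<psi> u"
proof -
  note * = has_derivative_mult[OF assms[unfolded frechet_derivative_works]]
  show "wirtinger x y (\<lambda>w. \<phi> w * \<psi> w) u = \<phi> u * wirtinger x y \<psi> u + wirtinger x y \<phi> u * \<psi> u"
    unfolding wirtinger_eq(1)[OF *] by (simp add: wirtinger_def field_simps)
  show "wirtinger_bar x y (\<lambda>w. \<phi> w * \<psi> w) u =
      \<phi> u * wirtinger_bar x y \<psi> u + wirtinger_bar x y \<phi> u * \<psi> u"
    unfolding wirtinger_eq(2)[OF *] by (simp add: wirtinger_bar_def field_simps)
qed

lemma wirtinger_bar_cnj:
  assumes "\<phi> differentiable (at u)"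
  shows "wirtinger_bar x y (\<lambda>w. cnj (\<phi> w)) u = cnj (wirtinger x y \<phi> u)"
  unfolding wirtinger_eq(2)[OF has_derivative_cnj[OF assms[unfolded frechet_derivative_works]]]
  by (simp add: wirtinger_def)

lemma wirtinger_cong:
  assumes "open S" "u \<in> S" "\<And>w. w \<in> S \<Longrightarrow> \<phi> w = \<psi> w"
  shows "wirtinger x y \<phi> u = wirtinger x y \<psi> u" "wirtinger_bar x y \<phi> u = wirtinger_bar x y \<psi> u"
proof -
  have "(\<phi> has_derivative D) (at u) \<longleftrightarrow> (\<psi> has_derivative D) (at u)" for D
    using has_derivative_transform_within_open[OF _ assms(1,2)] assms(3) by metis
  \<comment> \<open>\<open>frechet_derivative\<close> is a choice from the set of derivatives, so
    equality of these sets suffices, even if they are empty.\<close>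
  then have "frechet_derivative \<phi> (at u) = frechet_derivative \<psi> (at u)"
    by (simp add: frechet_derivative_def)
  then show "wirtinger x y \<phi> u = wirtinger x y \<psi> u" "wirtinger_bar x y \<phi> u = wirtinger_bar x y \<psi> u"
    by (simp_all add: wirtinger_def wirtinger_bar_def)
qed

lemma differentiable_transform_within_open:
  assumes "\<phi> differentiable (at u)" "open S" "u \<in> S" "\<And>w. w \<in> S \<Longrightarrow> \<phi> w = \<psi> w"
  shows "\<psi> differentiable (at u)"
  using assms has_derivative_transform_within_open unfolding differentiable_def by metis

lemma has_derivative_fibre_coord:
  "((\<lambda>w::coords. snd w $ l) has_derivative (\<lambda>h. snd h $ l)) (at u)"
  by (intro bounded_linear_imp_has_derivative bounded_linear_compose[OF bounded_linear_vec_nth]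
      bounded_linear_snd)

lemma differentiable_fibre_coord [simp]:
  "(\<lambda>w::coords. snd w $ l) differentiable (at u)"
  "(\<lambda>w::coords. cnj (snd w $ l)) differentiable (at u)"
  using has_derivative_fibre_coord has_derivative_cnj[OF has_derivative_fibre_coord]
  unfolding differentiable_def by blast+

lemma d_fibre_coord:
  "d_zbar k (\<lambda>w. snd w $ l) u = 0" "d_zbar k (\<lambda>w. cnj (snd w $ l)) u = 0"
  "d_etabar k (\<lambda>w. snd w $ l) u = 0" "d_eta k (\<lambda>w. cnj (snd w $ l)) u = 0"
  "d_etabar k (\<lambda>w. cnj (snd w $ l)) u = (if l = k then 1 else 0)"
  unfolding d_zbar_def d_etabar_def d_eta_def
    wirtinger_eq[OF has_derivative_fibre_coord] wirtinger_eq[OF has_derivative_cnj[OF has_derivative_fibre_coord]]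
  by (simp_all add: axis_def)

text \<open>The Frechet derivative is only real linear. Its values at \<open>\<eta>\<close> and
  \<open>\<i> *s \<eta>\<close> determine the conjugate linear and the complex linear part of the
  fibre derivative at \<open>\<eta>\<close>, and these are the two Wirtinger sums.\<close>

lemma euler_sum:
  assumes "\<phi> differentiable (at (z, \<eta>))"
  shows "(\<Sum>j\<in>UNIV. cnj (\<eta> $ j) * d_etabar j \<phi> (z, \<eta>)) =
    (frechet_derivative \<phi> (at (z, \<eta>)) (0, \<eta>) + \<i> * frechet_derivative \<phi> (at (z, \<eta>)) (0, \<i> *s \<eta>)) / 2"
    and "(\<Sum>j\<in>UNIV. \<eta> $ j * d_eta j \<phi> (z, \<eta>)) =
    (frechet_derivative \<phi> (at (z, \<eta>)) (0, \<eta>) - \<i> * frechet_derivative \<phi> (at (z, \<eta>)) (0, \<i> *s \<eta>)) / 2"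
proof -
  define D where "D = frechet_derivative \<phi> (at (z, \<eta>))"
  define a b where "a j = D (0, axis j 1)" and "b j = D (0, axis j \<i>)" for j :: 2
  have lin: "linear D"
    using assms linear_frechet_derivative D_def by blast
  \<comment> \<open>Expansion of a vertical vector in the real basis formed by the directions 1 and
    \<open>\<i>\<close> on each axis.\<close>
  have eq: "(0, v) = Re (v $ 1) *\<^sub>R (0, axis 1 1) + Im (v $ 1) *\<^sub>R (0, axis 1 \<i>) +
      Re (v $ 2) *\<^sub>R (0, axis 2 1) + Im (v $ 2) *\<^sub>R (0::complex^2, axis 2 \<i>)" for v :: "complex^2"
    by (auto simp: vec_eq_iff axis_def forall_2 complex_eq_iff)
  have D: "D (0, v) = Re (v $ 1) *\<^sub>R a 1 + Im (v $ 1) *\<^sub>R b 1 + Re (v $ 2) *\<^sub>R a 2 + Im (v $ 2) *\<^sub>R b 2" for v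
    by (subst eq) (simp only: linear_add[OF lin] linear_cmul[OF lin] a_def b_def)
  show "(\<Sum>j\<in>UNIV. cnj (\<eta> $ j) * d_etabar j \<phi> (z, \<eta>)) =
    (frechet_derivative \<phi> (at (z, \<eta>)) (0, \<eta>) + \<i> * frechet_derivative \<phi> (at (z, \<eta>)) (0, \<i> *s \<eta>)) / 2"
    unfolding d_etabar_def wirtinger_bar_def D_def[symmetric] a_def[symmetric] b_def[symmetric]
    unfolding D
    by (simp add: sum_2 complex_eq_iff algebra_simps add_divide_distrib diff_divide_distrib)
  show "(\<Sum>j\<in>UNIV. \<eta> $ j * d_eta j \<phi> (z, \<eta>)) =
    (frechet_derivative \<phi> (at (z, \<eta>)) (0, \<eta>) - \<i> * frechet_derivative \<phi> (at (z, \<eta>)) (0, \<i> *s \<eta>)) / 2"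
    unfolding d_eta_def wirtinger_def D_def[symmetric] a_def[symmetric] b_def[symmetric]
    unfolding D
    by (simp add: sum_2 complex_eq_iff algebra_simps add_divide_distrib diff_divide_distrib)
qed

section \<open>The conjugate horizontal derivative as a derivation\<close>

lemma delta_bar_add:
  assumes "\<phi> differentiable (at u)" "\<psi> differentiable (at u)"
  shows "delta_bar f k (\<lambda>w. \<phi> w + \<psi> w) u = delta_bar f k \<phi> u + delta_bar f k \<psi> u"
  by (simp add: delta_bar_def d_zbar_def d_etabar_def wirtinger_add assms sum_2 algebra_simps)

lemma delta_bar_mult:
  assumes "\<phi> differentiable (at u)" "\<psi> differentiable (at u)"
  shows "delta_bar f k (\<lambda>w. \<phi> w * \<psi> w) u = \<phi> u * delta_bar f k \<psi> u + delta_bar f k \<phi> u * \<psi> u"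
  by (simp add: delta_bar_def d_zbar_def d_etabar_def wirtinger_mult assms sum_2 algebra_simps)

lemma delta_bar_cong:
  assumes "open S" "u \<in> S" "\<And>w. w \<in> S \<Longrightarrow> \<phi> w = \<psi> w"
  shows "delta_bar f k \<phi> u = delta_bar f k \<psi> u"
  by (simp add: delta_bar_def d_zbar_def d_etabar_def wirtinger_cong[OF assms])

text \<open>Fibre coordinates are killed by both conjugate derivatives; on their conjugates only the
  vertical correction in \<open>delta_bar\<close> acts, which brings in the conjugate of
  \<open>N\<close>.\<close>

lemma delta_bar_fibre_coord:
  "delta_bar f k (\<lambda>w. snd w $ l) u = 0"
  "delta_bar f k (\<lambda>w. cnj (snd w $ l)) u = - cnj (N f u l k)"
  using exhaust_2[of l] by (auto simp: delta_bar_def d_fibre_coord sum_2)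

section \<open>Linear algebra\<close>

text \<open>A polynomial of degree at most 4 is determined by its values at the five points 0, 1,
  -1, 2, -2.\<close>

lemma polynomial4_vanishing:
  fixes a :: complex
  assumes "\<And>s::real. a + b * of_real s + c * (of_real s)^2 + d * (of_real s)^3 + e * (of_real s)^4 = 0"
  shows "a = 0 \<and> b = 0 \<and> c = 0 \<and> d = 0 \<and> e = 0"
  using assms[of 0] assms[of 1] assms[of "-1"] assms[of 2] assms[of "-2"]
  by (auto simp: complex_eq_iff)

text \<open>Putting \<open>t = s * w\<close> with real \<open>s\<close> separates the monomials by
  total degree; varying \<open>w\<close> then separates those of equal degree.\<close>

lemma hermitian_form_polynomial_vanishing:
  fixes c00 :: complex
  assumes "\<And>t. c00 + c01 * t + c02 * t^2 + c10 * cnj t + c11 * cnj t * t + c12 * cnj t * t^2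
      + c20 * (cnj t)^2 + c21 * (cnj t)^2 * t + c22 * (cnj t)^2 * t^2 = 0"
  shows "c00 = 0 \<and> c01 = 0 \<and> c02 = 0 \<and> c10 = 0 \<and> c11 = 0 \<and> c12 = 0 \<and> c20 = 0 \<and> c21 = 0 \<and> c22 = 0"
proof -
  have *: "c00 = 0 \<and> c01 * w + c10 * cnj w = 0 \<and> c02 * w^2 + c11 * cnj w * w + c20 * (cnj w)^2 = 0 \<and>
     c12 * cnj w * w^2 + c21 * (cnj w)^2 * w = 0 \<and> c22 * (cnj w)^2 * w^2 = 0" for w
  proof (rule polynomial4_vanishing)
    fix s :: real
    show "c00 + (c01 * w + c10 * cnj w) * of_real s
        + (c02 * w^2 + c11 * cnj w * w + c20 * (cnj w)^2) * (of_real s)^2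
        + (c12 * cnj w * w^2 + c21 * (cnj w)^2 * w) * (of_real s)^3
        + c22 * (cnj w)^2 * w^2 * (of_real s)^4 = 0"
      using assms[of "s * w"] by (simp add: algebra_simps power2_eq_square power3_eq_cube power4_eq_xxxx)
  qed
  show ?thesis
    \<comment> \<open>The values 1 and \<open>\<i>\<close> settle every degree except 2, where they
      leave \<open>c02 + c20 = 0\<close>; since the square of \<open>1 + \<i>\<close> is purely
      imaginary, the third value gives \<open>c02 = c20\<close>.\<close>
    using *[of 1] *[of \<i>] *[of "1 + \<i>"]
    by (auto simp: complex_eq_iff power2_eq_square algebra_simps)
qed

text \<open>Testing on the vectors \<open>(1, t)\<close> suffices.\<close>

lemma polarization_22:
  fixes S :: "2 \<Rightarrow> 2 \<Rightarrow> 2 \<Rightarrow> 2 \<Rightarrow> complex"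
  assumes sym: "\<And>r j h k. S r j h k = S r k h j" "\<And>r j h k. S r j h k = S h j r k"
    and zero: "\<And>v::complex^2. v \<noteq> 0 \<Longrightarrow>
      (\<Sum>r\<in>UNIV. \<Sum>j\<in>UNIV. \<Sum>h\<in>UNIV. \<Sum>k\<in>UNIV. S r j h k * cnj (v $ r) * v $ j * cnj (v $ h) * v $ k) = 0"
  shows "S r j h k = 0"
proof -
  \<comment> \<open>The symmetries reduce the sixteen terms to nine representatives with
    \<open>r \<le> h\<close> and \<open>j \<le> k\<close>; the factors 2 and 4 are the sizes of the
    orbits.\<close>
  have "S 1 1 1 1 + (2 * S 1 1 1 2) * t + S 1 2 1 2 * t^2 + (2 * S 1 1 2 1) * cnj t
      + (4 * S 1 1 2 2) * cnj t * t + (2 * S 1 2 2 2) * cnj t * t^2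
      + S 2 1 2 1 * (cnj t)^2 + (2 * S 2 1 2 2) * (cnj t)^2 * t + S 2 2 2 2 * (cnj t)^2 * t^2 = 0" for t
  proof -
    have "vector [1, t] \<noteq> (0::complex^2)"
      by (metis vector_2(1) zero_index zero_neq_one)
    from zero[OF this] show ?thesis
      by (simp add: sum_2 algebra_simps power2_eq_square sym(1)[of _ 2 _ 1] sym(2)[of 2 _ 1 _])
  qed
  from hermitian_form_polynomial_vanishing[OF this]
  have "S 1 1 1 1 = 0" "S 1 1 1 2 = 0" "S 1 2 1 2 = 0" "S 1 1 2 1 = 0" "S 1 1 2 2 = 0"
    "S 1 2 2 2 = 0" "S 2 1 2 1 = 0" "S 2 1 2 2 = 0" "S 2 2 2 2 = 0"
    by auto
  then show ?thesis
    using exhaust_2[of r] exhaust_2[of j] exhaust_2[of h] exhaust_2[of k]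
    by (auto simp: sym(1)[of _ 2 _ 1] sym(2)[of 2 _ 1 _])
qed

section \<open>Positive definite Hermitian matrices and inverses of 2 by 2 matrices\<close>

lemma hermitian_pos_def_det:
  assumes "hermitian_pos_def A"
  shows "Im (det A) = 0" "Re (det A) > 0"
proof -
  have h: "A $ i $ j = cnj (A $ j $ i)" for i j
    using assms unfolding hermitian_pos_def_def by blast
  have pos: "0 < Re (\<Sum>i\<in>UNIV. \<Sum>j\<in>UNIV. A $ i $ j * v $ i * cnj (v $ j))" if "v \<noteq> 0" for v
    using assms that unfolding hermitian_pos_def_def by blast
  have im: "Im (A $ 1 $ 1) = 0" "Im (A $ 2 $ 2) = 0"
    using arg_cong[OF h[of 1 1], of Im] arg_cong[OF h[of 2 2], of Im] by simp_all
  have a: "Re (A $ 1 $ 1) > 0"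
    using pos[of "axis 1 1"] by (simp add: sum_2 axis_def vec_eq_iff)
  have d: "det A = A $ 1 $ 1 * A $ 2 $ 2 - A $ 1 $ 2 * cnj (A $ 1 $ 2)"
    by (simp add: det_2 h[of 2 1])
  show "Im (det A) = 0" using im by (simp add: d)
  \<comment> \<open>This vector is orthogonal to the first axis with respect to the form, and the
    form takes the value \<open>A $ 1 $ 1 * det A\<close> on it.\<close>
  let ?v = "vector [- A $ 2 $ 1, A $ 1 $ 1] :: complex^2"
  have "?v \<noteq> 0" using a
    by (metis less_irrefl vector_2(2) zero_complex.simps(1) zero_index)
  from pos[OF this] have "0 < Re (A $ 1 $ 1) * Re (det A)"
    using im by (simp add: sum_2 d h[of 2 1] algebra_simps)
  then show "Re (det A) > 0" using a by (simp add: zero_less_mult_iff)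
qed

lemma matrix_inv_mult:
  assumes "invertible A"
  shows "A ** matrix_inv A = mat 1" "matrix_inv A ** A = mat 1"
  using someI_ex[OF assms[unfolded invertible_def]] unfolding matrix_inv_def by auto

text \<open>The adjugate formula. Arithmetic in the index type \<open>2\<close> is modulo 2, so
  \<open>3 - i\<close> is the index other than \<open>i\<close>. The explicit form later yields
  differentiability of the inverse metric.\<close>

lemma matrix_inv_2:
  fixes A :: "complex^2^2"
  assumes "det A \<noteq> 0"
  shows "matrix_inv A $ i $ j = (if i = j then A $ (3 - i) $ (3 - i) else - A $ i $ j) / det A"
proof -
  define e where "e = inverse (det A)"
  define B :: "complex^2^2"
    where "B = (\<chi> i j. (if i = j then A $ (3 - i) $ (3 - i) else - A $ i $ j) * e)"
  have "A $ 1 $ 1 * A $ 2 $ 2 * e - A $ 1 $ 2 * A $ 2 $ 1 * e = 1"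
    using assms by (simp add: e_def det_2 left_diff_distrib[symmetric])
  then have "A ** B = mat 1"
    by (simp add: vec_eq_iff forall_2 matrix_matrix_mult_def sum_2 B_def mat_def algebra_simps)
  then have "matrix_inv A = B"
    by (metis matrix_inv_mult(2) invertible_right_inverse matrix_mul_assoc matrix_mul_lid matrix_mul_rid)
  then show ?thesis by (simp add: B_def e_def divide_inverse)
qed

section \<open>Local representatives in bundle charts\<close>

locale complex_manifold_atlas =
  fixes M :: "'a topology" and \<A> :: "'a chart set"
  assumes manifold: "complex_manifold2 M \<A>"
begin

section \<open>Charts and the derivatives of transition maps\<close>

lemma chart_inj: "c \<in> \<A> \<Longrightarrow> inj_on (snd c) (fst c)"
proof -
  assume c: "c \<in> \<A>"
  have "homeomorphic_map (subtopology M (fst c)) (top_of_set (snd c ` fst c)) (snd c)" "openin M (fst c)"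
    using manifold c unfolding complex_manifold2_def by auto
  then show ?thesis
    using homeomorphic_imp_injective_map openin_subset topspace_subtopology_subset by metis
qed

text \<open>Supplies the open coordinate sets on which identities between transition maps may be
  differentiated.\<close>

lemma open_overlap_image:
  assumes "c \<in> \<A>" "openin M V"
  shows "open (snd c ` (fst c \<inter> V))"
proof -
  have c: "openin M (fst c)" "open (snd c ` fst c)"
    "homeomorphic_map (subtopology M (fst c)) (top_of_set (snd c ` fst c)) (snd c)"
    using manifold assms(1) unfolding complex_manifold2_def by auto
  have "openin (subtopology M (fst c)) (fst c \<inter> V)"
    using assms(2) by (simp add: openin_subtopology_Int2)
  then have "openin (top_of_set (snd c ` fst c)) (snd c ` (fst c \<inter> V))"
    using c(3) homeomorphic_imp_open_map open_map_def by blast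
  then show ?thesis
    using c(2) openin_open_trans by blast
qed

lemma open_chart_image: "c \<in> \<A> \<Longrightarrow> open (snd c ` fst c)"
  using manifold unfolding complex_manifold2_def by auto

lemma open_chart_domain: "c \<in> \<A> \<Longrightarrow> openin M (fst c)"
  using manifold unfolding complex_manifold2_def by auto

lemma transition_apply: "c \<in> \<A> \<Longrightarrow> p \<in> fst c \<Longrightarrow> transition c d (snd c p) = snd d p"
  by (simp add: transition_def chart_inj)

abbreviation jacobian :: "'a chart \<Rightarrow> 'a chart \<Rightarrow> 'a \<Rightarrow> complex^2 \<Rightarrow> complex^2" where
  "jacobian c d p \<equiv> frechet_derivative (transition c d) (at (snd c p))"

text \<open>By uniqueness the Frechet derivative is the complex matrix provided by holomorphy, hence
  it is complex linear.\<close>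

lemma transition_derivative:
  assumes "c \<in> \<A>" "d \<in> \<A>" "p \<in> fst c" "p \<in> fst d"
  shows "(transition c d has_derivative jacobian c d p) (at (snd c p))"
    and "jacobian c d p (a *s v) = a *s jacobian c d p v"
proof -
  have "holomorphic_map_on (snd c ` (fst c \<inter> fst d)) (transition c d)"
    using manifold assms unfolding complex_manifold2_def by blast
  then obtain A :: "complex^2^2" where A: "(transition c d has_derivative (\<lambda>h. A *v h)) (at (snd c p))"
    using assms unfolding holomorphic_map_on_def by blast
  then have eq: "jacobian c d p = (\<lambda>h. A *v h)"
    using frechet_derivative_at by metis
  show "(transition c d has_derivative jacobian c d p) (at (snd c p))"
    using A eq by simp
  show "jacobian c d p (a *s v) = a *s jacobian c d p v"
    by (simp add: eq vec.scale)
qed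

text \<open>The chain rule, applied on the image of the triple overlap, where the composed
  transitions agree with the direct one.\<close>

lemma jacobian_cocycle:
  assumes "c \<in> \<A>" "d \<in> \<A>" "e \<in> \<A>" "p \<in> fst c" "p \<in> fst d" "p \<in> fst e"
  shows "jacobian c e p v = jacobian d e p (jacobian c d p v)"
proof -
  have "((\<lambda>x. transition d e (transition c d x)) has_derivative
      (\<lambda>h. jacobian d e p (jacobian c d p h))) (at (snd c p))"
    by (rule has_derivative_compose[OF transition_derivative(1)])
      (use transition_derivative(1)[of d e p] assms in \<open>simp_all add: transition_apply\<close>)
  then have "(transition c e has_derivative (\<lambda>h. jacobian d e p (jacobian c d p h))) (at (snd c p))"
  proof (rule has_derivative_transform_within_open)
    show "open (snd c ` (fst c \<inter> (fst d \<inter> fst e)))"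
      by (intro open_overlap_image openin_Int open_chart_domain assms)
  qed (use assms in \<open>auto simp: transition_apply\<close>)
  then show ?thesis
    using frechet_derivative_at by metis
qed

lemma jacobian_self:
  assumes "c \<in> \<A>" "p \<in> fst c"
  shows "jacobian c c p v = v"
proof -
  have "(transition c c has_derivative (\<lambda>h. h)) (at (snd c p))"
    by (rule has_derivative_transform_within_open[OF has_derivative_ident open_chart_image[OF assms(1)]])
      (use assms in \<open>auto simp: transition_apply\<close>)
  then show ?thesis
    using frechet_derivative_at by metis
qed

text \<open>The inverse of the bundle chart on the fibre over \<open>p\<close>: the tangent vector
  whose components in the chart \<open>c\<close> are \<open>\<eta>\<close>. The value 0 elsewhere is
  the dummy value demanded by \<open>holo_tangent_space\<close>.\<close>

definition tangent_vector :: "'a chart \<Rightarrow> 'a \<Rightarrow> complex^2 \<Rightarrow> 'a chart \<Rightarrow> complex^2" where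
  "tangent_vector c p \<eta> d = (if d \<in> \<A> \<and> p \<in> fst d then jacobian c d p \<eta> else 0)"

lemma tangent_vector_in:
  assumes "c \<in> \<A>" "p \<in> fst c"
  shows "tangent_vector c p \<eta> \<in> holo_tangent_space \<A> p"
proof -
  have "tangent_vector c p \<eta> e = jacobian d e p (tangent_vector c p \<eta> d)"
    if "d \<in> \<A>" "e \<in> \<A>" "p \<in> fst d" "p \<in> fst e" for d e
    using jacobian_cocycle[OF assms(1) that(1,2) assms(2) that(3,4)] that
    by (simp add: tangent_vector_def)
  moreover have "tangent_vector c p \<eta> d = 0" if "d \<notin> \<A> \<or> p \<notin> fst d" for d
    using that by (auto simp: tangent_vector_def)
  ultimately show ?thesis
    unfolding holo_tangent_space_def by blast
qed

lemma tangent_vector_scale: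
  assumes "c \<in> \<A>" "p \<in> fst c"
  shows "tangent_vector c p (a *s \<eta>) = (\<lambda>d. a *s tangent_vector c p \<eta> d)"
  using transition_derivative(2)[OF assms(1) _ assms(2)]
  by (auto simp: tangent_vector_def)

lemma tangent_vector_unique:
  assumes "c \<in> \<A>" "p \<in> fst c" "v \<in> holo_tangent_space \<A> p"
  shows "v = tangent_vector c p (v c)"
proof
  fix d
  show "v d = tangent_vector c p (v c) d"
  proof (cases "d \<in> \<A> \<and> p \<in> fst d")
    case True
    then have "v d = jacobian c d p (v c)"
      using assms unfolding holo_tangent_space_def by blast
    then show ?thesis
      using True by (simp add: tangent_vector_def)
  next
    case False
    then have "v d = 0"
      using assms(3) unfolding holo_tangent_space_def by blast
    then show ?thesis
      using False by (simp only: tangent_vector_def if_False)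
  qed
qed

text \<open>The bundle chart is injective because a tangent vector is determined by its components
  in one chart, so \<open>inv_into\<close> returns \<open>tangent_vector\<close>. This carries
  positivity and homogeneity of \<open>F\<close> over to coordinates.\<close>

lemma local_rep_apply:
  assumes "c \<in> \<A>" "p \<in> fst c"
  shows "local_rep \<A> c F (snd c p, \<eta>) = F (p, tangent_vector c p \<eta>)"
proof -
  have "inj_on (bundle_chart c) (holo_tangent_bundle (fst c) \<A>)"
  proof (rule inj_onI)
    fix x y
    assume *: "x \<in> holo_tangent_bundle (fst c) \<A>" "y \<in> holo_tangent_bundle (fst c) \<A>"
      "bundle_chart c x = bundle_chart c y"
    obtain p v q w where xy: "x = (p, v)" "y = (q, w)"
      by (metis surj_pair)
    have in': "p \<in> fst c" "q \<in> fst c" "v \<in> holo_tangent_space \<A> p" "w \<in> holo_tangent_space \<A> q"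
      and "snd c p = snd c q" and eq: "v c = w c"
      using * by (simp_all add: xy holo_tangent_bundle_def bundle_chart_def)
    then have "p = q"
      using chart_inj[OF assms(1)] inj_onD by metis
    then show "x = y"
      using tangent_vector_unique[OF assms(1) in'(1,3)] tangent_vector_unique[OF assms(1) in'(2,4)]
      by (simp add: xy eq)
  qed
  moreover have "(p, tangent_vector c p \<eta>) \<in> holo_tangent_bundle (fst c) \<A>"
    using assms tangent_vector_in by (simp add: holo_tangent_bundle_def)
  moreover have "bundle_chart c (p, tangent_vector c p \<eta>) = (snd c p, \<eta>)"
    using assms by (simp add: bundle_chart_def tangent_vector_def jacobian_self)
  ultimately show ?thesis
    unfolding local_rep_def comp_def by (metis inv_into_f_f)
qed

end

section \<open>Curvature of a Kaehler metric in a chart\<close>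

text \<open>The setting of the local computation: \<open>U\<close> is the image of one chart and
  \<open>f\<close> the local representative of the Finsler function.\<close>

locale hermitian_chart =
  fixes U :: "(complex^2) set" and f :: "coords \<Rightarrow> real"
  assumes open_base: "open U"
    and smooth: "smooth_on (U \<times> (UNIV - {0})) (\<lambda>u. (f u)\<^sup>2)"
    and pos: "\<And>z \<eta>. z \<in> U \<Longrightarrow> \<eta> \<noteq> 0 \<Longrightarrow> f (z, \<eta>) > 0"
    and homog: "\<And>z \<eta> a. z \<in> U \<Longrightarrow> f (z, a *s \<eta>) = cmod a * f (z, \<eta>)"
    and posdef: "\<And>u. u \<in> U \<times> (UNIV - {0}) \<Longrightarrow> hermitian_pos_def (levi_metric f u)"
    and metric_basic: "\<And>z \<eta> \<eta>'. z \<in> U \<Longrightarrow> \<eta> \<noteq> 0 \<Longrightarrow> \<eta>' \<noteq> 0 \<Longrightarrow>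
      levi_metric f (z, \<eta>) = levi_metric f (z, \<eta>')"
    and kaehler: "\<And>u i k. u \<in> U \<times> (UNIV - {0}) \<Longrightarrow> (\<Sum>j\<in>UNIV. torsion f u i j k * snd u $ j) = 0"
begin

abbreviation D :: "coords set" where "D \<equiv> U \<times> (UNIV - {0})"
abbreviation L :: "coords \<Rightarrow> complex" where "L \<equiv> \<lambda>w. complex_of_real ((f w)\<^sup>2)"
abbreviation g :: "2 \<Rightarrow> 2 \<Rightarrow> coords \<Rightarrow> complex" where "g i j \<equiv> \<lambda>w. levi_metric f w $ i $ j"
abbreviation ginv :: "2 \<Rightarrow> 2 \<Rightarrow> coords \<Rightarrow> complex" where "ginv i j \<equiv> \<lambda>w. levi_metric_inv f w $ i $ j"

section \<open>Smoothness and Euler identities in a chart\<close>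

lemma open_D: "open D"
  using open_base by (intro open_Times) (auto simp: open_delete)

lemma same_fibreE:
  assumes "u \<in> D" "v \<in> D" "fst u = fst v"
  obtains z \<eta> \<eta>' where "u = (z, \<eta>)" "v = (z, \<eta>')" "z \<in> U" "\<eta> \<noteq> 0" "\<eta>' \<noteq> 0"
  by (rule that[of "fst u" "snd u" "snd v"]) (use assms in \<open>auto simp: prod_eq_iff\<close>)

lemma smooth_L: "smooth_on D L"
  by (rule smooth_on_bounded_linear[OF open_D bounded_linear_of_real smooth])

lemma smooth_g: "smooth_on D (g i j)"
  unfolding levi_metric_def d_eta_def d_etabar_def
  by (simp only: vec_lambda_beta) (intro smooth_on_wirtinger smooth_L open_D)

lemma smooth_dg: "smooth_on D (d_z k (g i j))"
  unfolding d_z_def by (simp add: smooth_on_wirtinger smooth_g open_D)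

lemmas differentiable_g = smooth_on_imp_differentiable[OF smooth_g]
lemmas differentiable_dg = smooth_on_imp_differentiable[OF smooth_dg]

text \<open>Homogeneity gives \<open>L (z, a *s \<eta>) = a * cnj a * L (z, \<eta>)\<close>.
  Comparing the derivatives of both sides in \<open>a\<close> at 1, in the directions 1 and
  \<open>\<i>\<close>, gives the two inputs of \<open>euler_sum\<close>.\<close>

lemma euler_L:
  assumes "u \<in> D"
  shows "(\<Sum>j\<in>UNIV. cnj (snd u $ j) * d_etabar j L u) = L u"
    and "(\<Sum>j\<in>UNIV. snd u $ j * d_eta j L u) = L u"
proof -
  obtain z \<eta> where u: "u = (z, \<eta>)" "z \<in> U" "\<eta> \<noteq> 0" using assms by auto
  define DL where "DL = frechet_derivative L (at (z, \<eta>))"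
  have diff: "L differentiable (at (z, \<eta>))"
    using smooth_on_imp_differentiable[OF smooth_L assms] u(1) by simp
  then have DL: "(L has_derivative DL) (at (z, \<eta>))"
    by (simp add: DL_def frechet_derivative_works)
  have "linear (\<lambda>a::complex. a *s \<eta>)"
    by (rule linearI) (simp_all add: vec_eq_iff algebra_simps)
  then have "bounded_linear (\<lambda>a::complex. a *s \<eta>)"
    by (simp add: linear_conv_bounded_linear)
  then have "((\<lambda>a::complex. (z, a *s \<eta>)) has_derivative (\<lambda>h. (0, h *s \<eta>))) (at 1)"
    by (intro has_derivative_Pair has_derivative_const bounded_linear_imp_has_derivative)
  from has_derivative_compose[OF this, of L DL] DL
  have "((\<lambda>a. L (z, a *s \<eta>)) has_derivative (\<lambda>h. DL (0, h *s \<eta>))) (at 1)"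
    by simp
  then have D1: "((\<lambda>a. a * cnj a * L (z, \<eta>)) has_derivative (\<lambda>h. DL (0, h *s \<eta>))) (at 1)"
    by (simp only: homog[OF u(2)] power_mult_distrib of_real_mult complex_norm_square)
  have D2: "((\<lambda>a. a * cnj a * L (z, \<eta>)) has_derivative (\<lambda>h. (h + cnj h) * L (z, \<eta>))) (at 1)"
    by (auto intro!: derivative_eq_intros simp: fun_eq_iff algebra_simps)
  have "(\<lambda>h. DL (0, h *s \<eta>)) = (\<lambda>h. (h + cnj h) * L (z, \<eta>))"
    by (rule has_derivative_unique[OF D1 D2])
  then have "DL (0, h *s \<eta>) = (h + cnj h) * L (z, \<eta>)" for h
    by meson
  from this[of 1] this[of \<i>] have "DL (0, \<eta>) = 2 * L (z, \<eta>)" "DL (0, \<i> *s \<eta>) = 0"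
    by simp_all
  then show "(\<Sum>j\<in>UNIV. cnj (snd u $ j) * d_etabar j L u) = L u"
    "(\<Sum>j\<in>UNIV. snd u $ j * d_eta j L u) = L u"
    using euler_sum[OF diff] by (simp_all add: u(1) DL_def)
qed

text \<open>Apply \<open>d_eta i\<close> to the first Euler identity; the conjugate fibre
  coordinates behave as constants.\<close>

lemma contract_metric:
  assumes "u \<in> D"
  shows "(\<Sum>j\<in>UNIV. g i j u * cnj (snd u $ j)) = d_eta i L u"
proof -
  have diff: "d_etabar j L differentiable (at u)" for j
    using smooth_on_imp_differentiable[OF smooth_on_wirtinger(2)[OF open_D smooth_L] assms]
    by (simp add: d_etabar_def)
  have "d_eta i L u = d_eta i (\<lambda>w. \<Sum>j\<in>UNIV. cnj (snd w $ j) * d_etabar j L w) u"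
    unfolding d_eta_def by (rule wirtinger_cong[OF open_D assms]) (simp only: euler_L(1))
  also have "\<dots> = (\<Sum>j\<in>UNIV. cnj (snd u $ j) * d_eta i (d_etabar j L) u)"
    using d_fibre_coord(4)[of i _ u]
    by (simp add: sum_2 d_eta_def wirtinger_add wirtinger_mult diff del: of_real_power)
  finally show ?thesis
    by (simp add: levi_metric_def mult.commute)
qed

lemma L_eq:
  assumes "u \<in> D"
  shows "L u = (\<Sum>i\<in>UNIV. \<Sum>j\<in>UNIV. g i j u * snd u $ i * cnj (snd u $ j))"
  using euler_L(2)[OF assms] contract_metric[OF assms, symmetric]
  by (simp add: sum_2 algebra_simps)

text \<open>Pullbacks from the base. Metric, connection coefficients \<open>Lc\<close> and curvature
  are of this kind, and on differentiable functions of this kind the horizontal derivatives reduce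
  to coordinate derivatives on the base.\<close>

definition basic :: "(coords \<Rightarrow> complex) \<Rightarrow> bool" where
  "basic \<phi> \<longleftrightarrow> (\<forall>u\<in>D. \<forall>v\<in>D. fst u = fst v \<longrightarrow> \<phi> u = \<phi> v)"

lemma basicI: "(\<And>u v. u \<in> D \<Longrightarrow> v \<in> D \<Longrightarrow> fst u = fst v \<Longrightarrow> \<phi> u = \<phi> v) \<Longrightarrow> basic \<phi>"
  unfolding basic_def by blast

lemma basicD: "basic \<phi> \<Longrightarrow> u \<in> D \<Longrightarrow> v \<in> D \<Longrightarrow> fst u = fst v \<Longrightarrow> \<phi> u = \<phi> v"
  unfolding basic_def by blast

text \<open>Near \<open>(z, \<eta>)\<close> the function equals its composition with the map that
  keeps the base point and replaces the fibre coordinate by \<open>\<eta>'\<close>; then the chain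
  rule applies. Equal fibre points give vanishing vertical derivatives, distinct ones show that base
  derivatives are again basic.\<close>

lemma frechet_derivative_basic:
  assumes "basic \<phi>" "z \<in> U" "\<eta> \<noteq> 0" "\<eta>' \<noteq> 0" "\<phi> differentiable (at (z, \<eta>'))"
  shows "frechet_derivative \<phi> (at (z, \<eta>)) h = frechet_derivative \<phi> (at (z, \<eta>')) (fst h, 0)"
proof -
  have "((\<lambda>w::coords. (fst w, \<eta>')) has_derivative (\<lambda>h. (fst h, 0))) (at (z, \<eta>))"
    by (intro has_derivative_Pair has_derivative_const bounded_linear_imp_has_derivative bounded_linear_fst)
  then have "((\<lambda>w. \<phi> (fst w, \<eta>')) has_derivative (\<lambda>h. frechet_derivative \<phi> (at (z, \<eta>')) (fst h, 0))) (at (z, \<eta>))"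
    by (rule has_derivative_compose) (use assms(5) in \<open>simp add: frechet_derivative_works\<close>)
  then have "(\<phi> has_derivative (\<lambda>h. frechet_derivative \<phi> (at (z, \<eta>')) (fst h, 0))) (at (z, \<eta>))"
  proof (rule has_derivative_transform_within_open[OF _ open_D])
    show "\<phi> (fst w, \<eta>') = \<phi> w" if "w \<in> D" for w
      by (rule basicD[OF assms(1)]) (use that assms(4) in auto)
  qed (use assms(2,3) in auto)
  then show ?thesis
    using frechet_derivative_at by metis
qed

lemma basic_d_eta:
  assumes "basic \<phi>" "u \<in> D" "\<phi> differentiable (at u)"
  shows "d_eta k \<phi> u = 0" "d_etabar k \<phi> u = 0"
proof -
  obtain z \<eta> where u: "u = (z, \<eta>)" "z \<in> U" "\<eta> \<noteq> 0" using assms(2) by auto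
  have "frechet_derivative \<phi> (at u) (0, h) = frechet_derivative \<phi> (at u) 0" for h
    using frechet_derivative_basic[OF assms(1) u(2,3,3), of "(0, h)"] assms(3)
    by (simp add: u(1) zero_prod_def)
  then have "frechet_derivative \<phi> (at u) (0, h) = 0" for h
    using linear_0[OF linear_frechet_derivative[OF assms(3)]] by simp
  then show "d_eta k \<phi> u = 0" "d_etabar k \<phi> u = 0"
    by (simp_all add: d_eta_def d_etabar_def wirtinger_def wirtinger_bar_def)
qed

lemma basic_d_z:
  assumes "basic \<phi>" "\<And>u. u \<in> D \<Longrightarrow> \<phi> differentiable (at u)"
  shows "basic (d_z k \<phi>)" "basic (d_zbar k \<phi>)"
proof -
  have "frechet_derivative \<phi> (at u) (h, 0) = frechet_derivative \<phi> (at v) (h, 0)"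
    if uv: "u \<in> D" "v \<in> D" "fst u = fst v" for u v h
  proof -
    obtain z \<eta> \<eta>' where z: "u = (z, \<eta>)" "v = (z, \<eta>')" "z \<in> U" "\<eta> \<noteq> 0" "\<eta>' \<noteq> 0"
      by (rule same_fibreE[OF uv])
    then show ?thesis
      using frechet_derivative_basic[OF assms(1) z(3-5), of "(h, 0)"] assms(2)[OF uv(2)] by simp
  qed
  note * = this
  show "basic (d_z k \<phi>)" "basic (d_zbar k \<phi>)"
    unfolding d_z_def d_zbar_def wirtinger_def wirtinger_bar_def
    by (rule basicI, metis *)+
qed

lemma delta_basic:
  assumes "basic \<phi>" "u \<in> D" "\<phi> differentiable (at u)"
  shows "delta f k \<phi> u = d_z k \<phi> u" "delta_bar f k \<phi> u = d_zbar k \<phi> u"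
  by (simp_all add: delta_def delta_bar_def basic_d_eta[OF assms])

section \<open>The metric, its inverse and the connection as objects on the base\<close>

lemma levi_metric_eq: "u \<in> D \<Longrightarrow> v \<in> D \<Longrightarrow> fst u = fst v \<Longrightarrow> levi_metric f u = levi_metric f v"
  by (erule (2) same_fibreE) (use metric_basic in blast)

lemma basic_g: "basic (g i j)"
  by (rule basicI) (metis levi_metric_eq)

lemma basic_ginv: "basic (ginv i j)"
  unfolding levi_metric_inv_def by (rule basicI) (metis levi_metric_eq)

lemma basic_dg: "basic (d_z k (g i j))" "basic (d_zbar k (g i j))"
  by (intro basic_d_z basic_g differentiable_g; assumption)+

lemma det_nonzero: "u \<in> D \<Longrightarrow> det (levi_metric f u) \<noteq> 0"
  using hermitian_pos_def_det(2)[OF posdef] by fastforce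

lemma differentiable_ginv:
  assumes "u \<in> D"
  shows "ginv i j differentiable (at u)"
proof (rule differentiable_transform_within_open[OF _ open_D assms])
  let ?\<phi> = "\<lambda>w. (if i = j then g (3 - i) (3 - i) w else - g i j w) /
    (g 1 1 w * g 2 2 w - g 1 2 w * g 2 1 w)"
  have [simp]: "g k l differentiable (at u)" for k l by (rule differentiable_g[OF assms])
  show "?\<phi> differentiable (at u)"
    using det_nonzero[OF assms] by (cases "i = j") (simp_all add: det_2)
  show "?\<phi> w = ginv i j w" if "w \<in> D" for w
    using det_nonzero[OF that] by (simp add: levi_metric_inv_def matrix_inv_2 det_2)
qed

lemma ginv_mult_g:
  assumes "u \<in> D"
  shows "(\<Sum>i\<in>UNIV. ginv l i u * g i r u) = (if l = r then 1 else 0)"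
proof -
  have "levi_metric_inv f u ** levi_metric f u = mat 1"
    unfolding levi_metric_inv_def using matrix_inv_mult(2) invertible_det_nz det_nonzero[OF assms] by blast
  then have "(levi_metric_inv f u ** levi_metric f u) $ l $ r = (if l = r then 1 else 0)"
    by (simp add: mat_def)
  then show ?thesis by (simp add: matrix_matrix_mult_def)
qed

lemma Lc_eq:
  assumes "u \<in> D"
  shows "Lc f u i j k = (\<Sum>l\<in>UNIV. ginv l i u * d_z k (g j l) u)"
  by (simp add: Lc_def delta_basic(1)[OF basic_g assms differentiable_g[OF assms]])

lemma basic_Lc: "basic (\<lambda>w. Lc f w i j k)"
proof (rule basicI)
  fix u v assume uv: "u \<in> D" "v \<in> D" "fst u = fst v"
  show "Lc f u i j k = Lc f v i j k"
    by (simp only: Lc_eq uv basicD[OF basic_ginv uv] basicD[OF basic_dg(1) uv])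
qed

lemma differentiable_Lc:
  assumes "u \<in> D"
  shows "(\<lambda>w. Lc f w i j k) differentiable (at u)"
proof (rule differentiable_transform_within_open[OF _ open_D assms])
  show "(\<lambda>w. \<Sum>l\<in>UNIV. ginv l i w * d_z k (g j l) w) differentiable (at u)"
    by (intro differentiable_sum differentiable_mult differentiable_ginv differentiable_dg assms ballI finite)
qed (simp add: Lc_eq)

text \<open>Contracting with the metric cancels the inverse metric, so no formula for the derivative
  of \<open>ginv\<close> is ever required.\<close>

lemma lower_Lc:
  assumes "u \<in> D"
  shows "(\<Sum>i\<in>UNIV. g i r u * Lc f u i j k) = d_z k (g j r) u"
proof -
  have "(\<Sum>i\<in>UNIV. g i r u * Lc f u i j k) =
      (\<Sum>l\<in>UNIV. d_z k (g j l) u * (\<Sum>i\<in>UNIV. ginv l i u * g i r u))"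
    by (simp add: Lc_eq[OF assms] sum_2 algebra_simps)
  also have "\<dots> = d_z k (g j r) u"
    using exhaust_2[of r] by (auto simp: ginv_mult_g[OF assms] sum_2)
  finally show ?thesis .
qed

lemma lower_N:
  assumes "u \<in> D"
  shows "(\<Sum>m\<in>UNIV. g m r u * N f u m h) = (\<Sum>l\<in>UNIV. d_z h (g l r) u * snd u $ l)"
proof -
  have "(\<Sum>m\<in>UNIV. g m r u * N f u m h) =
      (\<Sum>n\<in>UNIV. (\<Sum>l\<in>UNIV. d_z h (g l n) u * snd u $ l) * (\<Sum>m\<in>UNIV. ginv n m u * g m r u))"
    by (simp add: N_def sum_2 algebra_simps)
  also have "\<dots> = (\<Sum>l\<in>UNIV. d_z h (g l r) u * snd u $ l)"
    using exhaust_2[of r] by (auto simp: ginv_mult_g[OF assms] sum_2)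
  finally show ?thesis .
qed

section \<open>Hermitian symmetry and the Kaehler condition\<close>

lemma g_hermitian: "u \<in> D \<Longrightarrow> cnj (g i j u) = g j i u"
  by (rule sym) (use posdef[of u] in \<open>unfold hermitian_pos_def_def, blast\<close>)

lemma cnj_d_z_g:
  assumes "u \<in> D"
  shows "cnj (d_z k (g i j) u) = d_zbar k (g j i) u"
proof -
  have "d_zbar k (g j i) u = d_zbar k (\<lambda>w. cnj (g i j w)) u"
    unfolding d_zbar_def by (rule wirtinger_cong[OF open_D assms]) (simp add: g_hermitian)
  then show ?thesis
    by (simp add: d_zbar_def d_z_def wirtinger_bar_cnj differentiable_g[OF assms])
qed

lemma lower_cnj_N:
  assumes "u \<in> D"
  shows "(\<Sum>m\<in>UNIV. g r m u * cnj (N f u m h)) = (\<Sum>l\<in>UNIV. d_zbar h (g r l) u * cnj (snd u $ l))"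
  using arg_cong[OF lower_N[OF assms, of r h], of cnj]
  by (simp add: g_hermitian[OF assms] cnj_d_z_g[OF assms])

text \<open>The Kaehler condition only controls the torsion contracted with the fibre coordinate.
  Since \<open>Lc\<close> is basic, that coordinate can be moved to a coordinate axis, which
  isolates a single component.\<close>

lemma torsion_zero:
  assumes "u \<in> D"
  shows "Lc f u i j k = Lc f u i k j"
proof -
  have 1: "Lc f u i l k = Lc f (fst u, axis j 1) i l k" for l k
    by (rule basicD[OF basic_Lc assms]) (use assms in \<open>auto simp: axis_eq_0_iff\<close>)
  have "(fst u, axis j 1) \<in> D" using assms by (auto simp: axis_eq_0_iff)
  from kaehler[OF this, of i k] have "torsion f (fst u, axis j 1) i j k = 0"
    using exhaust_2[of j] by (auto simp: sum_2 axis_def)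
  then show ?thesis using 1 by (simp add: torsion_def)
qed

text \<open>Vanishing torsion with its upper index lowered: the classical closedness of the
  fundamental form.\<close>

lemma d_z_g_symmetric: "u \<in> D \<Longrightarrow> d_z k (g j r) u = d_z j (g k r) u"
  by (simp flip: lower_Lc add: torsion_zero[of u _ j k])

lemma d_zbar_g_symmetric: "u \<in> D \<Longrightarrow> d_zbar h (g i r) u = d_zbar r (g i h) u"
  by (simp flip: cnj_d_z_g add: d_z_g_symmetric[of u h r])

text \<open>The term with \<open>Cc\<close> vanishes because the metric is basic. Differentiating
  \<open>lower_Lc\<close> by the product rule expresses the remaining derivative of
  \<open>Lc\<close> through derivatives of the metric.\<close>

lemma R_low_eq:
  assumes "u \<in> D"
  shows "R_low f u r j h k =
    (\<Sum>i\<in>UNIV. d_zbar h (g i r) u * Lc f u i j k) - d_zbar h (d_z k (g j r)) u"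
proof -
  have "Cc f u i j l = 0" for i l
    by (simp add: Cc_def basic_d_eta[OF basic_g assms differentiable_g[OF assms]])
  then have "R_low f u r j h k = - (\<Sum>i\<in>UNIV. g i r u * d_zbar h (\<lambda>w. Lc f w i j k) u)"
    by (simp add: R_low_def Rc_def delta_basic(2)[OF basic_Lc assms differentiable_Lc[OF assms]] sum_negf)
  moreover have "d_zbar h (d_z k (g j r)) u = d_zbar h (\<lambda>w. \<Sum>i\<in>UNIV. g i r w * Lc f w i j k) u"
    unfolding d_zbar_def by (rule wirtinger_cong[OF open_D assms]) (simp add: lower_Lc)
  moreover have "\<dots> = (\<Sum>i\<in>UNIV. g i r u * d_zbar h (\<lambda>w. Lc f w i j k) u + d_zbar h (g i r) u * Lc f u i j k)"
    by (simp add: d_zbar_def sum_2 wirtinger_add wirtinger_mult differentiable_g differentiable_Lc assms)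
  ultimately show ?thesis
    by (simp add: sum.distrib)
qed

text \<open>The unbarred symmetry is immediate from the Kaehler identities. For the barred one, the
  mixed derivatives are first interchanged so that the conjugate Kaehler identity applies under
  \<open>d_z k\<close>.\<close>

lemma R_low_symmetric:
  assumes "u \<in> D"
  shows "R_low f u r j h k = R_low f u r k h j" "R_low f u r j h k = R_low f u h j r k"
proof -
  have "d_zbar h (d_z k (g j r)) u = d_zbar h (d_z j (g k r)) u"
    unfolding d_zbar_def by (rule wirtinger_cong[OF open_D assms]) (rule d_z_g_symmetric)
  then show "R_low f u r j h k = R_low f u r k h j"
    by (simp add: R_low_eq[OF assms] torsion_zero[OF assms, of _ j k])
  have "d_zbar h (d_z k (g j r)) u = d_z k (d_zbar h (g j r)) u" for h r
    unfolding d_zbar_def d_z_def by (rule wirtinger_commute[OF open_D assms smooth_g])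
  moreover have "d_z k (d_zbar h (g j r)) u = d_z k (d_zbar r (g j h)) u"
    unfolding d_z_def by (rule wirtinger_cong[OF open_D assms]) (rule d_zbar_g_symmetric)
  ultimately show "R_low f u r j h k = R_low f u h j r k"
    by (simp add: R_low_eq[OF assms] d_zbar_g_symmetric[OF assms, of h _ r])
qed

lemma basic_R_low: "basic (\<lambda>w. R_low f w r j h k)"
proof -
  have *: "basic (d_zbar h (d_z k (g j r)))"
    by (rule basic_d_z(2)[OF basic_dg(1) differentiable_dg])
  show ?thesis
  proof (rule basicI)
    fix u v assume uv: "u \<in> D" "v \<in> D" "fst u = fst v"
    show "R_low f u r j h k = R_low f v r j h k"
      by (simp only: R_low_eq uv basicD[OF * uv] basicD[OF basic_dg(2) uv] basicD[OF basic_Lc uv])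
  qed
qed

text \<open>The derivative of the metric coefficients cancels against the \<open>N\<close> terms
  produced by the conjugate fibre coordinates; \<open>lower_cnj_N\<close> is exactly this
  cancellation.\<close>

lemma delta_bar_L:
  assumes "u \<in> D"
  shows "delta_bar f h L u = 0"
proof -
  note diff = differentiable_g[OF assms]
  have mono: "delta_bar f h (\<lambda>w. g i j w * (snd w $ i * cnj (snd w $ j))) u =
      d_zbar h (g i j) u * (snd u $ i * cnj (snd u $ j)) - g i j u * snd u $ i * cnj (N f u j h)" for i j
    by (simp add: delta_bar_mult delta_bar_fibre_coord diff delta_basic(2)[OF basic_g assms diff])
  have "delta_bar f h L u =
      delta_bar f h (\<lambda>w. \<Sum>i\<in>UNIV. \<Sum>j\<in>UNIV. g i j w * (snd w $ i * cnj (snd w $ j))) u"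
    by (rule delta_bar_cong[OF open_D assms]) (simp only: L_eq mult.assoc)
  also have "\<dots> = (\<Sum>i\<in>UNIV. \<Sum>j\<in>UNIV.
      d_zbar h (g i j) u * (snd u $ i * cnj (snd u $ j)) - g i j u * snd u $ i * cnj (N f u j h))"
    by (simp only: sum_2) (simp add: delta_bar_add mono diff)
  also have "\<dots> = (\<Sum>i\<in>UNIV. snd u $ i * ((\<Sum>j\<in>UNIV. d_zbar h (g i j) u * cnj (snd u $ j))
      - (\<Sum>j\<in>UNIV. g i j u * cnj (N f u j h))))"
    by (simp add: sum_2 algebra_simps)
  also have "\<dots> = 0"
    by (simp add: lower_cnj_N[OF assms])
  finally show ?thesis .
qed

lemma f_pos: "u \<in> D \<Longrightarrow> f u > 0"
  by (erule SigmaE) (simp add: pos)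

text \<open>Smoothness is given for the square only; as \<open>f\<close> is positive on
  \<open>D\<close>, it is the square root of a positive differentiable function.\<close>

lemma differentiable_f:
  assumes "u \<in> D"
  shows "(\<lambda>w. complex_of_real (f w)) differentiable (at u)"
proof -
  obtain G where G: "((\<lambda>w. (f w)\<^sup>2) has_derivative G) (at u)"
    using smooth_on_imp_differentiable[OF smooth assms] by (auto simp: differentiable_def)
  have "((\<lambda>w. complex_of_real (sqrt ((f w)\<^sup>2))) has_derivative
      (\<lambda>h. complex_of_real (G h * (inverse (sqrt ((f u)\<^sup>2)) / 2)))) (at u)"
    using f_pos[OF assms]
    by (intro has_derivative_of_real has_derivative_real_sqrt[OF _ G, THEN has_derivative_eq_rhs]) (auto simp: mult_ac)
  then have "(\<lambda>w. complex_of_real (sqrt ((f w)\<^sup>2))) differentiable (at u)"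
    by (auto simp: differentiable_def)
  then show ?thesis
    by (rule differentiable_transform_within_open[OF _ open_D assms])
      (use f_pos in \<open>simp add: less_imp_le\<close>)
qed

lemma delta_bar_f:
  assumes "u \<in> D"
  shows "delta_bar f h (\<lambda>w. complex_of_real (f w)) u = 0"
proof -
  have "delta_bar f h L u = delta_bar f h (\<lambda>w. complex_of_real (f w) * complex_of_real (f w)) u"
    by (simp add: power2_eq_square)
  then show ?thesis
    using delta_bar_L[OF assms] f_pos[OF assms]
    by (simp add: delta_bar_mult differentiable_f[OF assms])
qed

text \<open>The numerator of \<open>J\<close>: multiplying by the cube of \<open>f\<close> clears
  the denominators of the frame, and lowering the upper index of \<open>Lc\<close> removes the
  inverse metric.\<close>

definition H :: "coords \<Rightarrow> complex" where
  "H w = (\<Sum>j\<in>UNIV. \<Sum>k\<in>UNIV. \<Sum>r\<in>UNIV.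
     d_z k (g j r) w * (snd w $ j * (snd w $ k * cnj (snd w $ r))))"

lemma J_eq:
  assumes "u \<in> D"
  shows "J f u = H u / (complex_of_real (f u))^3"
proof -
  have "J f u = (\<Sum>j\<in>UNIV. \<Sum>k\<in>UNIV. \<Sum>r\<in>UNIV. (\<Sum>i\<in>UNIV. g i r u * Lc f u i j k) *
     (snd u $ j * (snd u $ k * cnj (snd u $ r)))) / (complex_of_real (f u))^3"
    using f_pos[OF assms]
    by (simp add: J_def l_up_def l_low_def sum_2 field_simps power3_eq_cube)
  then show ?thesis
    by (simp add: H_def lower_Lc[OF assms])
qed

lemma differentiable_H:
  assumes "u \<in> D"
  shows "H differentiable (at u)"
  unfolding H_def[abs_def]
  by (intro differentiable_sum differentiable_mult differentiable_fibre_coord differentiable_dg assms ballI finite)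

text \<open>Differentiating the coefficients gives the second derivatives of the metric in
  \<open>R_low_eq\<close>; differentiating the conjugate fibre coordinates gives its product term,
  after rewriting \<open>N\<close>.\<close>

lemma delta_bar_H:
  assumes "u \<in> D"
  shows "delta_bar f h H u =
    - (\<Sum>r\<in>UNIV. \<Sum>j\<in>UNIV. \<Sum>k\<in>UNIV. R_low f u r j h k * cnj (snd u $ r) * snd u $ j * snd u $ k)"
proof -
  note diff = differentiable_dg[OF assms]
  have mono: "delta_bar f h (\<lambda>w. d_z k (g j r) w * (snd w $ j * (snd w $ k * cnj (snd w $ r)))) u =
      d_zbar h (d_z k (g j r)) u * (snd u $ j * (snd u $ k * cnj (snd u $ r)))
      - d_z k (g j r) u * (snd u $ j * (snd u $ k * cnj (N f u r h)))" for j k r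
    by (simp add: delta_bar_mult delta_bar_fibre_coord diff delta_basic(2)[OF basic_dg(1) assms diff])
  have "(\<Sum>r\<in>UNIV. d_z k (g j r) u * cnj (N f u r h)) =
      (\<Sum>i\<in>UNIV. Lc f u i j k * (\<Sum>r\<in>UNIV. g i r u * cnj (N f u r h)))" for j k
    by (simp add: lower_Lc[OF assms, symmetric] sum_2 algebra_simps)
  \<comment> \<open>The derivative of the metric was traded for \<open>Lc\<close> so that
    \<open>N\<close> is contracted with the metric and can itself be traded for a derivative of the
    metric.\<close>
  then have N: "(\<Sum>r\<in>UNIV. d_z k (g j r) u * cnj (N f u r h)) =
      (\<Sum>i\<in>UNIV. Lc f u i j k * (\<Sum>r\<in>UNIV. d_zbar h (g i r) u * cnj (snd u $ r)))" for j k
    by (simp only: lower_cnj_N[OF assms])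
  have "delta_bar f h H u = (\<Sum>j\<in>UNIV. \<Sum>k\<in>UNIV. \<Sum>r\<in>UNIV.
      d_zbar h (d_z k (g j r)) u * (snd u $ j * (snd u $ k * cnj (snd u $ r)))
      - d_z k (g j r) u * (snd u $ j * (snd u $ k * cnj (N f u r h))))"
    unfolding H_def[abs_def] by (simp only: sum_2) (simp add: delta_bar_add mono diff)
  also have "\<dots> = (\<Sum>j\<in>UNIV. \<Sum>k\<in>UNIV. snd u $ j * snd u $ k *
      ((\<Sum>r\<in>UNIV. d_zbar h (d_z k (g j r)) u * cnj (snd u $ r))
       - (\<Sum>r\<in>UNIV. d_z k (g j r) u * cnj (N f u r h))))"
    by (simp add: sum_2 algebra_simps)
  also have "\<dots> = - (\<Sum>r\<in>UNIV. \<Sum>j\<in>UNIV. \<Sum>k\<in>UNIV. R_low f u r j h k * cnj (snd u $ r) * snd u $ j * snd u $ k)"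
    unfolding N R_low_eq[OF assms] by (simp add: sum_2 algebra_simps)
  finally show ?thesis .
qed

text \<open>Since \<open>f\<close> is annihilated by \<open>delta_bar\<close>, its powers pass
  through the derivative as constants. The cube from \<open>J\<close> and the single denominator in
  \<open>K_inv\<close> add up to the fourth power, the square of \<open>L\<close>.\<close>

lemma K_inv_eq:
  assumes "u \<in> D"
  shows "K_inv f u * (L u)^2 = (\<Sum>r\<in>UNIV. \<Sum>j\<in>UNIV. \<Sum>h\<in>UNIV. \<Sum>k\<in>UNIV.
     R_low f u r j h k * cnj (snd u $ r) * snd u $ j * cnj (snd u $ h) * snd u $ k)"
proof -
  let ?F = "\<lambda>w. complex_of_real (f w)"
  note diff = differentiable_f[OF assms]
  have nz: "?F w \<noteq> 0" if "w \<in> D" for w using f_pos[OF that] by simp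
  have "(\<lambda>w. H w / (?F w)^3) differentiable (at u)"
    using nz[OF assms] differentiable_H[OF assms] diff by simp
  then have J: "J f differentiable (at u)"
    by (rule differentiable_transform_within_open[OF _ open_D assms]) (simp add: J_eq)
  have "delta_bar f h H u = ?F u ^ 3 * delta_bar f h (J f) u" for h
  proof -
    have "delta_bar f h H u = delta_bar f h (\<lambda>w. ?F w * (?F w * (?F w * J f w))) u"
      by (rule delta_bar_cong[OF open_D assms]) (use nz in \<open>simp add: J_eq power3_eq_cube\<close>)
    then show ?thesis
      by (simp add: delta_bar_mult diff J delta_bar_f[OF assms] power3_eq_cube mult.assoc)
  qed
  then have "K_inv f u * (L u)^2 = - (\<Sum>h\<in>UNIV. cnj (snd u $ h) * delta_bar f h H u)"
    using nz[OF assms] by (simp add: K_inv_def sum_2 field_simps power2_eq_square power3_eq_cube)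
  then show ?thesis
    unfolding delta_bar_H[OF assms] by (simp add: sum_2 algebra_simps)
qed

text \<open>Both sides are symmetric in the unbarred and in the barred indices, do not depend on the fibre
  coordinate, and by \<open>K_inv_eq\<close> agree as forms on each fibre; so polarization applies.\<close>

lemma R_low_constant_curvature:
  assumes K: "\<And>u. u \<in> D \<Longrightarrow> K_inv f u = K" and u: "u \<in> D"
  shows "R_low f u r j h k = K / 2 * (g j r u * g k h u + g k r u * g j h u)"
proof -
  define S where "S r j h k = R_low f u r j h k - K / 2 * (g j r u * g k h u + g k r u * g j h u)" for r j h k
  have "S r j h k = 0"
  proof (rule polarization_22)
    show "S r j h k = S r k h j" for r j h k
      by (simp add: S_def R_low_symmetric(1)[OF u, of r j] algebra_simps)
    show "S r j h k = S h j r k" for r j h k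
      by (simp add: S_def R_low_symmetric(2)[OF u, of r j] algebra_simps)
    fix v :: "complex^2" assume "v \<noteq> 0"
    \<comment> \<open>The test vector must range over the whole fibre, so \<open>u\<close> is moved
      along its fibre to \<open>v\<close>; the coefficients of the two forms stay the same.\<close>
    define w where "w = (fst u, v)"
    have w: "w \<in> D" "fst w = fst u" using u \<open>v \<noteq> 0\<close> by (auto simp: w_def)
    have eq: "R_low f u r j h k = R_low f w r j h k" "g i j u = g i j w" for r i j h k
      using basicD[OF basic_R_low u w(1)] basicD[OF basic_g u w(1)] w(2) by simp_all
    have "K * (\<Sum>i\<in>UNIV. \<Sum>j\<in>UNIV. g i j w * v $ i * cnj (v $ j))^2 =
      (\<Sum>r\<in>UNIV. \<Sum>j\<in>UNIV. \<Sum>h\<in>UNIV. \<Sum>k\<in>UNIV.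
        R_low f w r j h k * cnj (v $ r) * v $ j * cnj (v $ h) * v $ k)"
      using K_inv_eq[OF w(1)] unfolding K[OF w(1)] L_eq[OF w(1)] by (simp add: w_def)
    then show "(\<Sum>r\<in>UNIV. \<Sum>j\<in>UNIV. \<Sum>h\<in>UNIV. \<Sum>k\<in>UNIV.
        S r j h k * cnj (v $ r) * v $ j * cnj (v $ h) * v $ k) = 0"
      \<comment> \<open>Each of the two products of metric coefficients contracts to the square of
        the norm form, which cancels the factor 1/2.\<close>
      unfolding S_def eq by (simp add: sum_2 power2_eq_square algebra_simps)
  qed
  then show ?thesis by (simp add: S_def)
qed

text \<open>Contracting the constant curvature tensor with \<open>X\<close> gives
  \<open>2 * K\<close> times the square of the norm form at \<open>X\<close>, so both frame
  directions need only be shown to have unit length.\<close>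

lemma horizontal_hsc_unit:
  assumes "\<And>u. u \<in> D \<Longrightarrow> K_inv f u = K" "u \<in> D"
    and unit: "(\<Sum>i\<in>UNIV. \<Sum>j\<in>UNIV. g i j u * X $ i * cnj (X $ j)) = 1"
  shows "horizontal_hsc f u X = 2 * K"
proof -
  have R: "R_low f u r j h k = K / 2 * (g j r u * g k h u + g k r u * g j h u)" for r j h k
    by (rule R_low_constant_curvature[OF _ assms(2)]) (rule assms(1))
  have "horizontal_hsc f u X = 2 * K * (\<Sum>i\<in>UNIV. \<Sum>j\<in>UNIV. g i j u * X $ i * cnj (X $ j))^2"
    unfolding horizontal_hsc_def R
    by (simp add: sum_2 power2_eq_square algebra_simps)
  then show ?thesis by (simp add: unit)
qed

section \<open>Unit length of the frame vectors\<close>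

lemma l_up_unit:
  assumes "u \<in> D"
  shows "(\<Sum>i\<in>UNIV. \<Sum>j\<in>UNIV. g i j u * l_up f u $ i * cnj (l_up f u $ j)) = 1"
proof -
  have "(\<Sum>i\<in>UNIV. \<Sum>j\<in>UNIV. g i j u * l_up f u $ i * cnj (l_up f u $ j)) = L u / (complex_of_real (f u))^2"
    unfolding L_eq[OF assms] by (simp add: l_up_def sum_2 power2_eq_square add_divide_distrib)
  then show ?thesis using f_pos[OF assms] by simp
qed

text \<open>With \<open>a\<close>, \<open>b\<close> the lowered components of the unit vector
  \<open>l_up f u\<close>, the metric form on \<open>(-b, a)\<close> is
  \<open>det (levi_metric f u)\<close> times the form on \<open>l_up f u\<close>, an instance of the
  adjugate identity. Dividing by the root of the determinant normalizes it.\<close>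

lemma m_up_unit:
  assumes "u \<in> D"
  shows "(\<Sum>i\<in>UNIV. \<Sum>j\<in>UNIV. g i j u * m_up f u $ i * cnj (m_up f u $ j)) = 1"
proof -
  define d where "d = det (levi_metric f u)"
  define s where "s = csqrt d"
  have "Im d = 0" "Re d > 0"
    using hermitian_pos_def_det[OF posdef[OF assms]] by (simp_all add: d_def)
  then have "d = complex_of_real (Re d)" by (simp add: complex_eq_iff)
  \<comment> \<open>The root is real, so \<open>s * cnj s\<close> in the norm is
    \<open>s * s = d\<close>.\<close>
  then have "s = complex_of_real (sqrt (Re d))"
    using \<open>Re d > 0\<close> unfolding s_def by (metis less_imp_le of_real_sqrt)
  then have s: "cnj s = s" "s \<noteq> 0"
    using \<open>Re d > 0\<close> by auto
  have ss: "s * s = d"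
    by (simp add: s_def flip: power2_eq_square)
  define a b where "a = l_low f u $ 1" and "b = l_low f u $ 2"
  define x y where "x = l_up f u $ 1" and "y = l_up f u $ 2"
  have ab: "a = g 1 1 u * cnj x + g 1 2 u * cnj y" "b = g 2 1 u * cnj x + g 2 2 u * cnj y"
    by (simp_all add: a_def b_def x_def y_def l_low_def l_up_def sum_2 add_divide_distrib)
  have cab: "cnj a = g 1 1 u * x + g 2 1 u * y" "cnj b = g 1 2 u * x + g 2 2 u * y"
    by (simp_all add: ab g_hermitian[OF assms])
  have m: "m_up f u $ 1 = - b / s" "m_up f u $ 2 = a / s"
    by (simp_all add: m_up_def a_def b_def s_def d_def)
  have l: "g 1 1 u * x * cnj x + g 1 2 u * x * cnj y + g 2 1 u * y * cnj x + g 2 2 u * y * cnj y = 1"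
    using l_up_unit[OF assms] by (simp add: sum_2 x_def y_def add.assoc)
  have "(\<Sum>i\<in>UNIV. \<Sum>j\<in>UNIV. g i j u * m_up f u $ i * cnj (m_up f u $ j)) =
    (g 1 1 u * b * cnj b - g 1 2 u * b * cnj a - g 2 1 u * a * cnj b + g 2 2 u * a * cnj a) / d"
    by (simp add: sum_2 m s(1) add_divide_distrib diff_divide_distrib flip: ss)
  also have "g 1 1 u * b * cnj b - g 1 2 u * b * cnj a - g 2 1 u * a * cnj b + g 2 2 u * a * cnj a =
    (g 1 1 u * g 2 2 u - g 1 2 u * g 2 1 u) *
    (g 1 1 u * x * cnj x + g 1 2 u * x * cnj y + g 2 1 u * y * cnj x + g 2 2 u * y * cnj y)"
    \<comment> \<open>The conjugates are replaced first; expanding \<open>a\<close> and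
      \<open>b\<close> inside \<open>cnj a\<close> and \<open>cnj b\<close> would hide them from
      \<open>cab\<close>.\<close>
    unfolding cab unfolding ab by (simp add: algebra_simps)
  also have "\<dots> = d"
    unfolding l by (simp add: d_def det_2)
  finally show ?thesis
    using s(2) ss by auto
qed

end

theorem theorem4p13:
  fixes M :: "'a topology"
    and \<A> :: "'a chart set"
    and F :: "'a \<times> ('a chart \<Rightarrow> complex^2) \<Rightarrow> real"
    and K :: complex
  assumes "complex_finsler_space2 M \<A> F"
    and "kaehler \<A> F"
    and "purely_hermitian \<A> F"
    and "\<forall>c\<in>\<A>. \<forall>u\<in>slit_domain c. K_inv (local_rep \<A> c F) u = K"
  shows "\<forall>c\<in>\<A>. \<forall>u\<in>slit_domain c. let f = local_rep \<A> c F; g = levi_metric f u in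
           (\<forall>r j h k. R_low f u r j h k =
              K / 2 * (g $ j $ r * g $ k $ h + g $ k $ r * g $ j $ h)) \<and>
           horizontal_hsc f u (l_up f u) = 2 * K \<and>
           horizontal_hsc f u (m_up f u) = 2 * K"
proof (intro ballI)
  fix c u assume c: "c \<in> \<A>" and u: "u \<in> slit_domain c"
  define f where "f = local_rep \<A> c F"
  have "complex_manifold2 M \<A>"
    using assms(1) by (simp add: complex_finsler_space2_def)
  then interpret complex_manifold_atlas M \<A> by unfold_locales
  have F: "0 \<le> F (p, v)" "F (p, v) = 0 \<longleftrightarrow> v = (\<lambda>c. 0)" "F (p, \<lambda>c. a *s v c) = cmod a * F (p, v)"
    if "p \<in> topspace M" "v \<in> holo_tangent_space \<A> p" for p v a
    using assms(1) that unfolding complex_finsler_space2_def by blast+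
  have top: "p \<in> topspace M" if "p \<in> fst c" for p
    using that openin_subset[OF open_chart_domain[OF c]] by blast
  interpret hermitian_chart "snd c ` fst c" f
  proof
    show "open (snd c ` fst c)" by (rule open_chart_image[OF c])
    show "smooth_on (snd c ` fst c \<times> (UNIV - {0})) (\<lambda>u. (f u)\<^sup>2)"
      using assms(1) c unfolding complex_finsler_space2_def f_def slit_domain_def by blast
    show "hermitian_pos_def (levi_metric f u)" if "u \<in> snd c ` fst c \<times> (UNIV - {0})" for u
      using assms(1) c that unfolding complex_finsler_space2_def f_def slit_domain_def by blast
    show "(\<Sum>j\<in>UNIV. torsion f u i j k * snd u $ j) = 0" if "u \<in> snd c ` fst c \<times> (UNIV - {0})" for u i k
      using assms(2) c that unfolding kaehler_def f_def slit_domain_def by blast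
    show "levi_metric f (z, \<eta>) = levi_metric f (z, \<eta>')"
      if "z \<in> snd c ` fst c" "\<eta> \<noteq> 0" "\<eta>' \<noteq> 0" for z \<eta> \<eta>'
      using assms(3) c that unfolding purely_hermitian_def f_def slit_domain_def by blast
    \<comment> \<open>Homogeneity and positivity are hypotheses on the bundle rather than in
      coordinates, so they are transported through \<open>tangent_vector\<close>.\<close>
    fix z \<eta> a assume "z \<in> snd c ` fst c"
    then obtain p where p: "z = snd c p" "p \<in> fst c" by auto
    note v = top[OF p(2)] tangent_vector_in[OF c p(2)]
    show "f (z, a *s \<eta>) = cmod a * f (z, \<eta>)"
      by (simp add: f_def p(1) local_rep_apply[OF c p(2)] tangent_vector_scale[OF c p(2)] F(3)[OF v])
    assume "\<eta> \<noteq> 0"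
    \<comment> \<open>Its component in the chart \<open>c\<close> itself is \<open>\<eta>\<close>,
      so the vector is not the zero vector and \<open>F\<close> is nonzero on it.\<close>
    then have "tangent_vector c p \<eta> c \<noteq> 0"
      using c p(2) by (simp add: tangent_vector_def jacobian_self)
    then have "F (p, tangent_vector c p \<eta>) \<noteq> 0"
      using F(2)[OF v] by auto
    then show "f (z, \<eta>) > 0"
      using F(1)[OF v, of \<eta>] by (simp add: f_def p(1) local_rep_apply[OF c p(2)])
  qed
  have K: "K_inv f u = K" if "u \<in> D" for u
    using assms(4) c that unfolding f_def slit_domain_def by blast
  have u: "u \<in> D"
    using u by (simp only: slit_domain_def)
  show "let f = local_rep \<A> c F; g = levi_metric f u in
           (\<forall>r j h k. R_low f u r j h k =
              K / 2 * (g $ j $ r * g $ k $ h + g $ k $ r * g $ j $ h)) \<and>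
           horizontal_hsc f u (l_up f u) = 2 * K \<and>
           horizontal_hsc f u (m_up f u) = 2 * K"
    unfolding Let_def f_def[symmetric]
    by (intro conjI allI R_low_constant_curvature[OF _ u] horizontal_hsc_unit[OF _ u]
        l_up_unit[OF u] m_up_unit[OF u] K)
qed

end
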